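(* Let $\mathcal{S}=\mathcal{L}\oplus\mathcal{F}^{-1/2}$ be the Krichever–Novikov Lie superalgebra of $(\Sigma,A,L)$ with the almost-grading induced by a splitting $A=I\cup O$. There are no non-trivial central extensions of $\mathcal{S}$ with odd central element coming from a bounded cocycle. In other words, all central extensions of $\mathcal{S}$ with odd central element defined by a bounded (from above) cocycle split.
   Context: **Algebras.** $\Sigma$ is a compact Riemann surface of arbitrary genus $g$, $A\subset\Sigma$ a finite set, $\mathcal{K}$ the canonical line bundle, $L$ a fixed line bundle with $L^{\otimes 2}=\mathcal{K}$ (theta characteristic). For $\lambda\in\frac12\mathbb{Z}$, $\mathcal{K}^\lambda:=L^{\otimes 2\lambda}$ (negative powers via the dual bundle), and $\mathcal{F}^\lambda$ is the complex vector space of global meromorphic sections of $\mathcal{K}^\lambda$ holomorphic on $\Sigma\setminus A$. Locally elements are $f(z)(dz)^\lambda$; the same symbol is used for a section and its local representing function, and $'$ is $d/dz$. $\mathcal{L}:=\mathcal{F}^{-1}$ (vector fields) with the Lie bracket $[e,f]=(ef'-fe')\frac{d}{dz}$. For $e\in\mathcal{L}$, $\varphi\in\mathcal{F}^{-1/2}$: $e.\varphi=(e\varphi'-\frac12\varphi e')(dz)^{-1/2}$. For $\varphi,\psi\in\mathcal{F}^{-1/2}$, $\varphi\cdot\psi\in\mathcal{L}$ is the product of sections. $\mathcal{S}:=\mathcal{L}\oplus\mathcal{F}^{-1/2}$, with even part $\mathcal{S}_{\bar0}=\mathcal{L}$, odd part $\mathcal{S}_{\bar1}=\mathcal{F}^{-1/2}$,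 is the Lie superalgebra with bracket extending that of $\mathcal{L}$ by $[e,\varphi]=-[\varphi,e]=e.\varphi$, $[\varphi,\psi]=\varphi\cdot\psi$. **Central extensions with odd central element.** An odd super-cocycle is a bilinear $c:\mathcal{S}\times\mathcal{S}\to\mathbb{C}$ vanishing on pairs of elements of equal parity, with $c(x,y)=-(-1)^{\bar x\bar y}c(y,x)$ and $$(-1)^{\bar x\bar z}c(x,[y,z])+(-1)^{\bar y\bar x}c(y,[z,x])+(-1)^{\bar z\bar y}c(z,[x,y])=0$$ for $x,y,z$ of pure parity. It defines the central extension $\widehat{\mathcal{S}}=\mathbb{C}t\oplus\mathcal{S}$ with $t$ odd and central and $[\hat x,\hat y]=\widehat{[x,y]}+c(x,y)t$, $\hat x=(0,x)$. Two such extensions are equivalent iff their cocycles differ by a coboundary $\delta_1k(x,y)=k([x,y])$, $k:\mathcal{S}\to\mathbb{C}$ linear and odd (vanishing on $\mathcal{S}_{\bar0}$); an extension is trivial (split) iff its cocycle is a coboundary. **Almost-grading.** $A=I\cup O$ is a fixed splitting into nonempty disjoint sets $I=\{P_1,\dots,P_K\}$, $O=\{Q_1,\dots,Q_M\}$. A separating cycle $C_S$ is a smooth cycle in $\Sigma\setminus A$ homologous there to the sum of small positively oriented circles around the points $P_i$. The Krichever–Novikov pairing is $\mathcal{F}^\lambda\times\mathcal{F}^{1-\lambda}\to\mathbb{C}$, $\langle f,g\rangle=\frac1{2\pi\mathrm{i}}\int_{C_S}f\cdot g$. Let $\mathbb{J}_\lambda=\mathbb{Z}$ for $\lambda\in\mathbb{Z}$,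 $\mathbb{J}_\lambda=\mathbb{Z}+\frac12$ for $\lambda\in\mathbb{Z}+\frac12$. Fix local coordinates $z_p$ centered at $P_p$. One fixes Krichever–Novikov bases $\{f^\lambda_{n,p}\mid n\in\mathbb{J}_\lambda,\ 1\le p\le K\}$ of $\mathcal{F}^\lambda$ (known to exist; needed for $\lambda\in\{-1,-\frac12,\frac32,2\}$) with: (1) $\mathrm{ord}_{P_i}(f^\lambda_{n,p})\ge(n+1-\lambda)-\delta_i^p$ for all $i$ (with equality generically), and $f^\lambda_{n,p}=z_p^{\,n-\lambda}(1+O(z_p))(dz_p)^\lambda$ near $P_p$; (2) duality $\langle f^\lambda_{n,p},f^{1-\lambda}_{-m,r}\rangle=\delta_p^r\delta_n^m$; (3) at the out-points, $\mathrm{ord}_{Q_j}(f^\lambda_{n,p})\ge-\alpha_j n-B$ for all $n,p,j$, with constants $\alpha_j>0$, $\sum_j\alpha_j=K$, and $B$ independent of $n,p,\lambda$. Put $\mathcal{F}^\lambda_n=\mathrm{span}\{f^\lambda_{n,p}\mid p=1,\dots,K\}$, and for $n\in\frac12\mathbb{Z}$ let $\mathcal{S}_n=\mathcal{F}^{-1}_n$ if $n\in\mathbb{Z}$, $\mathcal{S}_n=\mathcal{F}^{-1/2}_n$ if $n\in\mathbb{Z}+\frac12$. Then $\mathcal{S}=\bigoplus_n\mathcal{S}_n$ is almost-graded: $\dim\mathcal{S}_n<\infty$ and there are constants $L_1,L_2$ with $[\mathcal{S}_n,\mathcal{S}_m]\subseteq\bigoplus_{h=n+m-L_1}^{n+m+L_2}\mathcal{S}_h$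 for all $n,m$. **Bounded.** A cocycle $c$ is bounded (from above) if there is $M_2\in\mathbb{Z}$ such that for all $n,m$: $c(\mathcal{S}_n,\mathcal{S}_m)\ne0\Rightarrow n+m\le M_2$. *)

theory Defs
  imports
    "HOL-Complex_Analysis.Complex_Analysis"
    "HOL-Homology.Homology"
    "HOL-Library.Function_Algebras"
    "HOL-Library.Landau_Symbols"
begin

section \<open>Compact Riemann surfaces and theta characteristics\<close>

text \<open>
  The points of the surface are the elements of a topological type. The holomorphic structure is
  given by an arbitrary (not necessarily maximal) holomorphic atlas, indexed by a type.
\<close>

record ('i, 'a) surface_atlas =
  patch :: "'i \<Rightarrow> 'a set"
  chart :: "'i \<Rightarrow> 'a \<Rightarrow> complex"

definition chart_inv :: "('i, 'a) surface_atlas \<Rightarrow> 'i \<Rightarrow> complex \<Rightarrow> 'a" where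
  "chart_inv X i = inv_into (patch X i) (chart X i)"

definition compact_riemann_surface :: "('i, 'a::t2_space) surface_atlas \<Rightarrow> bool" where
  "compact_riemann_surface X \<longleftrightarrow>
     compact (UNIV :: 'a set) \<and> connected (UNIV :: 'a set) \<and>
     (\<Union>i. patch X i) = UNIV \<and>
     (\<forall>i. open (patch X i) \<and> open (chart X i ` patch X i) \<and>
          homeomorphism (patch X i) (chart X i ` patch X i) (chart X i) (chart_inv X i)) \<and>
     (\<forall>i j. (chart X j \<circ> chart_inv X i) holomorphic_on chart X i ` (patch X i \<inter> patch X j))"

text \<open>
  A holomorphic line bundle is given by its transition functions \<open>g i j\<close> with respect to the cover
  of the atlas. The convention is that the local representing functions of a section satisfy
  \<open>s i = g i j * s j\<close> on overlaps.
\<close>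

definition line_bundle :: "('i, 'a::t2_space) surface_atlas \<Rightarrow> ('i \<Rightarrow> 'i \<Rightarrow> 'a \<Rightarrow> complex) \<Rightarrow> bool" where
  "line_bundle X g \<longleftrightarrow>
     (\<forall>i j. (g i j \<circ> chart_inv X i) holomorphic_on chart X i ` (patch X i \<inter> patch X j)) \<and>
     (\<forall>i j. \<forall>p \<in> patch X i \<inter> patch X j. g i j p \<noteq> 0) \<and>
     (\<forall>i. \<forall>p \<in> patch X i. g i i p = 1) \<and>
     (\<forall>i j k. \<forall>p \<in> patch X i \<inter> patch X j \<inter> patch X k. g i j p * g j k p = g i k p)"

text \<open>
  The canonical bundle has the local frames \<open>dz\<^sub>i\<close>, where \<open>z\<^sub>i = chart X i\<close>; hence its transition
  functions are \<open>dz\<^sub>j / dz\<^sub>i\<close>.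
\<close>

definition canonical_bundle :: "('i, 'a) surface_atlas \<Rightarrow> 'i \<Rightarrow> 'i \<Rightarrow> 'a \<Rightarrow> complex" where
  "canonical_bundle X i j p = deriv (chart X j \<circ> chart_inv X i) (chart X i p)"

text \<open>
  In \<open>L \<otimes> L = K\<close> the local frames of \<open>L\<close> are the \<open>(dz\<^sub>i)\<^bsup>1/2\<^esup>\<close>, i.e. they square to \<open>dz\<^sub>i\<close>. Every
  square root of the canonical bundle has such frames for a sufficiently fine atlas, for instance
  one whose patches are simply connected.
\<close>

definition theta_characteristic ::
    "('i, 'a::t2_space) surface_atlas \<Rightarrow> ('i \<Rightarrow> 'i \<Rightarrow> 'a \<Rightarrow> complex) \<Rightarrow> bool" where
  "theta_characteristic X L \<longleftrightarrow>
     line_bundle X L \<and>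
     (\<forall>i j. \<forall>p \<in> patch X i \<inter> patch X j. (L i j p)\<^sup>2 = canonical_bundle X i j p)"

text \<open>The bundle \<open>K\<^bsup>\<lambda>\<^esup>\<close>, that is the \<open>2\<lambda>\<close>-th tensor power of \<open>L\<close>, for a half-integer \<open>\<lambda>\<close>.\<close>

definition K_power :: "('i \<Rightarrow> 'i \<Rightarrow> 'a \<Rightarrow> complex) \<Rightarrow> real \<Rightarrow> 'i \<Rightarrow> 'i \<Rightarrow> 'a \<Rightarrow> complex" where
  "K_power L lam i j p = L i j p powi \<lfloor>2 * lam\<rfloor>"


section \<open>Meromorphic sections\<close>

text \<open>
  A section is the family of its local representing functions, \<open>s i\<close> being a function of the
  coordinate \<open>chart X i\<close>. A section of a bundle that is holomorphic off \<open>A\<close> is determined by its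
  values off \<open>A\<close>; so that equality of families is equality of sections, \<open>s i\<close> is normalised to be
  \<open>0\<close> at the points of \<open>A\<close> and outside the coordinate patch. This does not restrict the behaviour
  at \<open>A\<close>: being meromorphic there, and the order, depend on punctured neighbourhoods only.
\<close>

type_synonym 'i sec = "'i \<Rightarrow> complex \<Rightarrow> complex"

definition meromorphic_sections ::
    "('i, 'a::t2_space) surface_atlas \<Rightarrow> ('i \<Rightarrow> 'i \<Rightarrow> 'a \<Rightarrow> complex) \<Rightarrow> 'a set \<Rightarrow> 'i sec set" where
  "meromorphic_sections X g A =
     {s. \<forall>i. s i meromorphic_on chart X i ` patch X i \<and>
             s i holomorphic_on chart X i ` (patch X i - A) \<and>
             (\<forall>w. w \<notin> chart X i ` (patch X i - A) \<longrightarrow> s i w = 0) \<and>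
             (\<forall>j. \<forall>p \<in> patch X i \<inter> patch X j - A.
                s i (chart X i p) = g i j p * s j (chart X j p))}"

definition F_space ::
    "('i, 'a::t2_space) surface_atlas \<Rightarrow> ('i \<Rightarrow> 'i \<Rightarrow> 'a \<Rightarrow> complex) \<Rightarrow> 'a set \<Rightarrow> real \<Rightarrow> 'i sec set" where
  "F_space X L A lam = meromorphic_sections X (K_power L lam) A"

definition sec_scale :: "complex \<Rightarrow> 'i sec \<Rightarrow> 'i sec" where
  "sec_scale a s = (\<lambda>i w. a * s i w)"

global_interpretation sec: vector_space sec_scale
  by unfold_locales (auto simp: sec_scale_def fun_eq_iff algebra_simps)

text \<open>Does not depend on the chosen chart; meaningful for sections that are not identically zero.\<close>

definition sec_order :: "('i, 'a) surface_atlas \<Rightarrow> 'i sec \<Rightarrow> 'a \<Rightarrow> int" where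
  "sec_order X s p = (let i = SOME i. p \<in> patch X i in zorder (s i) (chart X i p))"


section \<open>The Krichever--Novikov Lie superalgebra\<close>

definition sec_mult :: "'i sec \<Rightarrow> 'i sec \<Rightarrow> 'i sec" where
  "sec_mult s t = (\<lambda>i w. s i w * t i w)"

definition vf_bracket :: "'i sec \<Rightarrow> 'i sec \<Rightarrow> 'i sec" where
  "vf_bracket e f = (\<lambda>i w. e i w * deriv (f i) w - f i w * deriv (e i) w)"

definition vf_action :: "'i sec \<Rightarrow> 'i sec \<Rightarrow> 'i sec" where
  "vf_action e \<phi> = (\<lambda>i w. e i w * deriv (\<phi> i) w - 1/2 * \<phi> i w * deriv (e i) w)"

type_synonym 'i super = "'i sec \<times> 'i sec"

definition super_space ::
    "('i, 'a::t2_space) surface_atlas \<Rightarrow> ('i \<Rightarrow> 'i \<Rightarrow> 'a \<Rightarrow> complex) \<Rightarrow> 'a set \<Rightarrow> 'i super set" where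
  "super_space X L A = F_space X L A (-1) \<times> F_space X L A (-1/2)"

definition super_part ::
    "('i, 'a::t2_space) surface_atlas \<Rightarrow> ('i \<Rightarrow> 'i \<Rightarrow> 'a \<Rightarrow> complex) \<Rightarrow> 'a set \<Rightarrow> nat \<Rightarrow> 'i super set" where
  "super_part X L A par =
     (if even par then F_space X L A (-1) \<times> {0} else {0} \<times> F_space X L A (-1/2))"

definition super_scale :: "complex \<Rightarrow> 'i super \<Rightarrow> 'i super" where
  "super_scale a x = (sec_scale a (fst x), sec_scale a (snd x))"

text \<open>
  Bilinear extension of \<open>[e, f]\<close> on vector fields, \<open>[e, \<psi>] = - [\<psi>, e] = e.\<psi>\<close> and
  \<open>[\<phi>, \<psi>] = \<phi> \<cdot> \<psi>\<close>.
\<close>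

definition super_bracket :: "'i super \<Rightarrow> 'i super \<Rightarrow> 'i super" where
  "super_bracket x y =
     (case x of (e, \<phi>) \<Rightarrow> case y of (f, \<psi>) \<Rightarrow>
        (vf_bracket e f + sec_mult \<phi> \<psi>, vf_action e \<psi> - vf_action f \<phi>))"


section \<open>Central extensions with odd central element\<close>

definition linear_functional_on :: "'i super set \<Rightarrow> ('i super \<Rightarrow> complex) \<Rightarrow> bool" where
  "linear_functional_on V k \<longleftrightarrow>
     (\<forall>x\<in>V. \<forall>y\<in>V. k (x + y) = k x + k y) \<and> (\<forall>a. \<forall>x\<in>V. k (super_scale a x) = a * k x)"

definition odd_super_cocycle ::
    "('i, 'a::t2_space) surface_atlas \<Rightarrow> ('i \<Rightarrow> 'i \<Rightarrow> 'a \<Rightarrow> complex) \<Rightarrow> 'a set \<Rightarrow>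
     ('i super \<Rightarrow> 'i super \<Rightarrow> complex) \<Rightarrow> bool" where
  "odd_super_cocycle X L A c \<longleftrightarrow>
     (\<forall>x \<in> super_space X L A. linear_functional_on (super_space X L A) (\<lambda>y. c x y)) \<and>
     (\<forall>y \<in> super_space X L A. linear_functional_on (super_space X L A) (\<lambda>x. c x y)) \<and>
     (\<forall>a \<in> {0, 1}. \<forall>x \<in> super_part X L A a. \<forall>y \<in> super_part X L A a. c x y = 0) \<and>
     (\<forall>a \<in> {0, 1}. \<forall>b \<in> {0, 1}. \<forall>x \<in> super_part X L A a. \<forall>y \<in> super_part X L A b.
        c x y = - ((-1) ^ (a * b) * c y x)) \<and>
     (\<forall>a \<in> {0, 1}. \<forall>b \<in> {0, 1}. \<forall>d \<in> {0, 1}.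
        \<forall>x \<in> super_part X L A a. \<forall>y \<in> super_part X L A b. \<forall>z \<in> super_part X L A d.
          (-1) ^ (a * d) * c x (super_bracket y z)
          + (-1) ^ (b * a) * c y (super_bracket z x)
          + (-1) ^ (d * b) * c z (super_bracket x y) = 0)"

definition odd_coboundary ::
    "('i, 'a::t2_space) surface_atlas \<Rightarrow> ('i \<Rightarrow> 'i \<Rightarrow> 'a \<Rightarrow> complex) \<Rightarrow> 'a set \<Rightarrow>
     ('i super \<Rightarrow> 'i super \<Rightarrow> complex) \<Rightarrow> bool" where
  "odd_coboundary X L A c \<longleftrightarrow>
     (\<exists>k. linear_functional_on (super_space X L A) k \<and> (\<forall>x \<in> super_part X L A 0. k x = 0) \<and>
          (\<forall>x \<in> super_space X L A. \<forall>y \<in> super_space X L A. c x y = k (super_bracket x y)))"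

text \<open>
  The central extension \<open>\<complex> t \<oplus> S\<close> defined by \<open>c\<close>; the pair \<open>(a, x)\<close> stands for \<open>a t + x\<close>.
\<close>

definition ext_bracket ::
    "('i super \<Rightarrow> 'i super \<Rightarrow> complex) \<Rightarrow> complex \<times> 'i super \<Rightarrow> complex \<times> 'i super \<Rightarrow> complex \<times> 'i super" where
  "ext_bracket c u v = (c (snd u) (snd v), super_bracket (snd u) (snd v))"

text \<open>The central element \<open>t\<close> is odd.\<close>

definition ext_part ::
    "('i, 'a::t2_space) surface_atlas \<Rightarrow> ('i \<Rightarrow> 'i \<Rightarrow> 'a \<Rightarrow> complex) \<Rightarrow> 'a set \<Rightarrow> nat \<Rightarrow>
     (complex \<times> 'i super) set" where
  "ext_part X L A par = (if even par then {0} else UNIV) \<times> super_part X L A par"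

text \<open>
  The projection of the extension onto \<open>S\<close> has a section which is an (even) homomorphism of Lie
  superalgebras.
\<close>

definition ext_splits ::
    "('i, 'a::t2_space) surface_atlas \<Rightarrow> ('i \<Rightarrow> 'i \<Rightarrow> 'a \<Rightarrow> complex) \<Rightarrow> 'a set \<Rightarrow>
     ('i super \<Rightarrow> 'i super \<Rightarrow> complex) \<Rightarrow> bool" where
  "ext_splits X L A c \<longleftrightarrow>
     (\<exists>\<sigma>. (\<forall>x \<in> super_space X L A. snd (\<sigma> x) = x) \<and>
          (\<forall>x \<in> super_space X L A. \<forall>y \<in> super_space X L A. \<sigma> (x + y) = \<sigma> x + \<sigma> y) \<and>
          (\<forall>a. \<forall>x \<in> super_space X L A.
             \<sigma> (super_scale a x) = (a * fst (\<sigma> x), super_scale a (snd (\<sigma> x)))) \<and>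
          (\<forall>par \<in> {0, 1}. \<forall>x \<in> super_part X L A par. \<sigma> x \<in> ext_part X L A par) \<and>
          (\<forall>x \<in> super_space X L A. \<forall>y \<in> super_space X L A.
             \<sigma> (super_bracket x y) = ext_bracket c (\<sigma> x) (\<sigma> y)))"


section \<open>Separating cycles and the Krichever--Novikov pairing\<close>

text \<open>A piecewise continuously differentiable path (parametrised by the unit interval).\<close>

definition smooth_path :: "('i, 'a::t2_space) surface_atlas \<Rightarrow> (real \<Rightarrow> 'a) \<Rightarrow> bool" where
  "smooth_path X \<gamma> \<longleftrightarrow>
     path \<gamma> \<and>
     (\<forall>i a b. {a..b} \<subseteq> {0..1} \<and> \<gamma> ` {a..b} \<subseteq> patch X i \<longrightarrow>
        (chart X i \<circ> \<gamma>) piecewise_C1_differentiable_on {a..b})"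

text \<open>
  The integral of the differential given by the local functions \<open>\<omega>\<close>. The integrand is computed in
  any chart around the point \<open>\<gamma> t\<close>; for a section of the canonical bundle it does not depend on the
  choice of that chart.
\<close>

definition path_integral :: "('i, 'a) surface_atlas \<Rightarrow> (real \<Rightarrow> 'a) \<Rightarrow> 'i sec \<Rightarrow> complex" where
  "path_integral X \<gamma> \<omega> =
     integral {0..1} (\<lambda>t. let i = SOME i. \<gamma> t \<in> patch X i in
       \<omega> i (chart X i (\<gamma> t)) * vector_derivative (chart X i \<circ> \<gamma>) (at t within {0..1}))"

text \<open>
  A path, transported to the standard 1-simplex by \<open>t \<mapsto> (1 - t, t)\<close>, as a singular 1-chain. Finite
  formal sums of paths are lists; negative coefficients are accounted for by reversed paths.
\<close>

definition path_chain :: "(real \<Rightarrow> 'a) \<Rightarrow> 'a chain" where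
  "path_chain \<gamma> = frag_of (restrict (\<lambda>x. \<gamma> (x 1)) (standard_simplex 1))"

definition chart_circle :: "('i, 'a) surface_atlas \<Rightarrow> 'i \<Rightarrow> real \<Rightarrow> real \<Rightarrow> 'a" where
  "chart_circle X i r = chart_inv X i \<circ> circlepath 0 r"

text \<open>
  \<open>C\<close> is homologous in the complement of \<open>A\<close> to the sum of small circles around the \<open>P p\<close>; here
  \<open>zc p\<close> is the index of a chart centred at \<open>P p\<close>. That \<open>C\<close> is a cycle is implied.
\<close>

definition separating_cycle ::
    "('i, 'a::t2_space) surface_atlas \<Rightarrow> 'a set \<Rightarrow> nat \<Rightarrow> (nat \<Rightarrow> 'a) \<Rightarrow> (nat \<Rightarrow> 'i) \<Rightarrow>
     (real \<Rightarrow> 'a) list \<Rightarrow> bool" where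
  "separating_cycle X A K P zc C \<longleftrightarrow>
     (\<forall>\<gamma> \<in> set C. smooth_path X \<gamma> \<and> path_image \<gamma> \<subseteq> - A) \<and>
     (\<exists>r. (\<forall>p \<in> {1..K}. r p > 0 \<and> cball 0 (r p) \<subseteq> chart X (zc p) ` patch X (zc p) \<and>
                        chart_inv X (zc p) ` cball 0 (r p) \<inter> A = {P p}) \<and>
          homologous_rel 1 (top_of_set (- A)) {}
            (\<Sum>\<gamma>\<leftarrow>C. path_chain \<gamma>)
            (\<Sum>p = 1..K. path_chain (chart_circle X (zc p) (r p))))"

definition KN_pairing :: "('i, 'a) surface_atlas \<Rightarrow> (real \<Rightarrow> 'a) list \<Rightarrow> 'i sec \<Rightarrow> 'i sec \<Rightarrow> complex" where
  "KN_pairing X C f g = 1 / (2 * pi * \<i>) * (\<Sum>\<gamma>\<leftarrow>C. path_integral X \<gamma> (sec_mult f g))"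


section \<open>Krichever--Novikov bases and bounded cocycles\<close>

definition KN_index :: "real \<Rightarrow> real set" where
  "KN_index lam = (if lam \<in> \<int> then \<int> else {n. n - 1/2 \<in> \<int>})"

text \<open>
  \<open>f lam n p\<close> is the basis element \<open>f\<^bsup>\<lambda>\<^esup>\<^bsub>n,p\<^esub>\<close>. The local coordinate at \<open>P p\<close> is \<open>chart X (zc p)\<close>,
  and the local representing function of a section \<open>s\<close> with respect to it is \<open>s (zc p)\<close>.
\<close>

definition KN_bases ::
    "('i, 'a::t2_space) surface_atlas \<Rightarrow> ('i \<Rightarrow> 'i \<Rightarrow> 'a \<Rightarrow> complex) \<Rightarrow> nat \<Rightarrow> nat \<Rightarrow>
     (nat \<Rightarrow> 'a) \<Rightarrow> (nat \<Rightarrow> 'a) \<Rightarrow> (nat \<Rightarrow> 'i) \<Rightarrow> (real \<Rightarrow> 'a) list \<Rightarrow>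
     (real \<Rightarrow> real \<Rightarrow> nat \<Rightarrow> 'i sec) \<Rightarrow> bool" where
  "KN_bases X L K M P Q zc C f \<longleftrightarrow>
     (let A = P ` {1..K} \<union> Q ` {1..M}; \<Lambda> = {-1, -1/2, 3/2, 2} in
       (\<forall>lam \<in> \<Lambda>.
          inj_on (\<lambda>(n, p). f lam n p) (KN_index lam \<times> {1..K}) \<and>
          sec.independent ((\<lambda>(n, p). f lam n p) ` (KN_index lam \<times> {1..K})) \<and>
          sec.span ((\<lambda>(n, p). f lam n p) ` (KN_index lam \<times> {1..K})) = F_space X L A lam) \<and>
       (\<forall>lam \<in> \<Lambda>. \<forall>n \<in> KN_index lam. \<forall>p \<in> {1..K}.
          (\<forall>i \<in> {1..K}. sec_order X (f lam n p) (P i) \<ge> (n + 1 - lam) - of_bool (i = p)) \<and>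
          (\<exists>u. u \<in> O[at 0](\<lambda>w. w) \<and>
               (\<forall>\<^sub>F w in at 0. f lam n p (zc p) w = w powi \<lfloor>n - lam\<rfloor> * (1 + u w)))) \<and>
       (\<forall>lam \<in> \<Lambda>. \<forall>n \<in> KN_index lam. \<forall>m \<in> KN_index lam. \<forall>p \<in> {1..K}. \<forall>r \<in> {1..K}.
          KN_pairing X C (f lam n p) (f (1 - lam) (- m) r) = of_bool (p = r) * of_bool (n = m)) \<and>
       (\<exists>(\<alpha> :: nat \<Rightarrow> real) (B :: real).
          (\<forall>j \<in> {1..M}. \<alpha> j > 0) \<and> (\<Sum>j = 1..M. \<alpha> j) = K \<and>
          (\<forall>lam \<in> \<Lambda>. \<forall>n \<in> KN_index lam. \<forall>p \<in> {1..K}. \<forall>j \<in> {1..M}.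
             sec_order X (f lam n p) (Q j) \<ge> - \<alpha> j * n - B)))"

definition F_degree :: "nat \<Rightarrow> (real \<Rightarrow> real \<Rightarrow> nat \<Rightarrow> 'i sec) \<Rightarrow> real \<Rightarrow> real \<Rightarrow> 'i sec set" where
  "F_degree K f lam n = sec.span ((\<lambda>p. f lam n p) ` {1..K})"

definition S_degree :: "nat \<Rightarrow> (real \<Rightarrow> real \<Rightarrow> nat \<Rightarrow> 'i sec) \<Rightarrow> real \<Rightarrow> 'i super set" where
  "S_degree K f n =
     (if n \<in> \<int> then F_degree K f (-1) n \<times> {0} else {0} \<times> F_degree K f (-1/2) n)"

definition bounded_cocycle ::
    "nat \<Rightarrow> (real \<Rightarrow> real \<Rightarrow> nat \<Rightarrow> 'i sec) \<Rightarrow> ('i super \<Rightarrow> 'i super \<Rightarrow> complex) \<Rightarrow> bool" where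
  "bounded_cocycle K f c \<longleftrightarrow>
     (\<exists>M\<^sub>2 :: int. \<forall>n m. 2 * n \<in> \<int> \<and> 2 * m \<in> \<int> \<and>
        (\<exists>x \<in> S_degree K f n. \<exists>y \<in> S_degree K f m. c x y \<noteq> 0) \<longrightarrow> n + m \<le> M\<^sub>2)"

end

theory Submission
  imports Defs
begin

text \<open>
  An odd cocycle vanishes on pairs of equal parity, so it amounts to its mixed part
  \<open>b e \<phi> = c (e, 0) (0, \<phi>)\<close>, a bilinear form pairing vector fields with sections of weight \<open>-1/2\<close>.
  The cocycle identity for two even elements and one odd element says that \<open>b\<close> is a 1-cocycle of the
  Lie algebra of vector fields with values in the dual of the module of weight \<open>-1/2\<close>, and \<open>c\<close> is
  a coboundary iff \<open>b e \<phi> = \<kappa> (e.\<phi>)\<close> for some linear functional \<open>\<kappa>\<close>.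

  The functional is found with an Euler field. Filter both spaces by the vanishing order at all
  in-points simultaneously. The field \<open>e\<^sub>0 = (\<Sum>p. f\<^bsup>-1\<^esup>\<^bsub>0,p\<^esub>)\<close> agrees with \<open>z d/dz\<close> up to
  second order terms at every in-point, so it acts on the graded pieces by scalars: by the integer degree \<open>n\<close> on
  vector fields and by the half-integer degree \<open>m\<close> on sections of weight \<open>-1/2\<close>
  (\<open>lie_derivative_euler\<close>). Since \<open>m\<close> never vanishes, \<open>\<phi> \<mapsto> e\<^sub>0.\<phi>\<close> is invertible modulo every step of
  the filtration. Boundedness makes \<open>b e\<^sub>0\<close> vanish on a deep step, so that \<open>\<kappa> (e\<^sub>0.\<phi>) = b e\<^sub>0 \<phi>\<close>
  defines \<open>\<kappa>\<close>. The corrected form \<open>b' e \<phi> = b e \<phi> - \<kappa> (e.\<phi>)\<close> is a cocycle with \<open>b' e\<^sub>0 = 0\<close>, hence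
  \<open>b' [e\<^sub>0, e] \<phi> + b' e (e\<^sub>0.\<phi>) = 0\<close>. In degrees \<open>n\<close> and \<open>m\<close> this reads \<open>(n + m) b' e \<phi> = 0\<close> up to
  values of \<open>b'\<close> on deeper pairs, and \<open>n + m\<close> is a half-integer, hence nonzero. As \<open>b'\<close> vanishes on
  deep pairs, descending induction on \<open>n + m\<close> gives \<open>b' = 0\<close>. This argument is purely algebraic and is
  carried out in the locale \<open>filtered_euler_cocycle\<close>.

  The rest supplies the hypotheses of that locale. Vector fields act on both spaces by Lie
  derivatives, which preserve meromorphic sections (\<open>lie_derivative_closed\<close>) and satisfy the Jacobi
  identity; orders are read off from Laurent expansions in the coordinates at the in-points.
  Boundedness is a condition on the degrees of basis elements, and it passes to the filtration
  because an element vanishing to high order is a combination of basis elements of high degree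
  (\<open>order_filtration_subset_span_from\<close>).
\<close>

section \<open>Cocycles on filtered modules with an Euler element\<close>

text \<open>
  Here \<open>n\<close> indexes the integer weights in \<open>V\<close>, and the index \<open>m\<close> of a step of \<open>W\<close> stands for the
  weight \<open>m + 1/2\<close>. The Jacobi and cocycle identities are required with \<open>e\<^sub>0\<close> as one of the two
  elements of \<open>V\<close>: the argument compares everything with the Euler element.
\<close>
locale filtered_euler_cocycle =
  V: vector_space scaleV + W: vector_space scaleW
  for scaleV :: "complex \<Rightarrow> 'v::ab_group_add \<Rightarrow> 'v"
    and scaleW :: "complex \<Rightarrow> 'w::ab_group_add \<Rightarrow> 'w" +
  fixes V :: "'v set" and W :: "'w set"
    and FV :: "int \<Rightarrow> 'v set" and FW :: "int \<Rightarrow> 'w set"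
    and br :: "'v \<Rightarrow> 'v \<Rightarrow> 'v" and act :: "'v \<Rightarrow> 'w \<Rightarrow> 'w"
    and e\<^sub>0 :: 'v and b :: "'v \<Rightarrow> 'w \<Rightarrow> complex" and R :: int
  assumes subspace_V: "V.subspace V" and subspace_W: "W.subspace W"
    and subspace_FW: "W.subspace (FW n)"
    and FV_subset: "FV n \<subseteq> V" and FW_subset: "FW n \<subseteq> W"
    and FW_Suc: "FW (n + 1) \<subseteq> FW n"
    and FV_exhaust: "v \<in> V \<Longrightarrow> \<exists>n. v \<in> FV n" and FW_exhaust: "w \<in> W \<Longrightarrow> \<exists>n. w \<in> FW n"
    and act_add_left: "\<lbrakk>v \<in> V; v' \<in> V; w \<in> W\<rbrakk> \<Longrightarrow> act (v + v') w = act v w + act v' w"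
    and act_add_right: "\<lbrakk>v \<in> V; w \<in> W; w' \<in> W\<rbrakk> \<Longrightarrow> act v (w + w') = act v w + act v w'"
    and act_scale_left: "\<lbrakk>v \<in> V; w \<in> W\<rbrakk> \<Longrightarrow> act (scaleV a v) w = scaleW a (act v w)"
    and act_scale_right: "\<lbrakk>v \<in> V; w \<in> W\<rbrakk> \<Longrightarrow> act v (scaleW a w) = scaleW a (act v w)"
    and act_filtration: "\<lbrakk>v \<in> FV n; w \<in> FW m\<rbrakk> \<Longrightarrow> act v w \<in> FW (n + m)"
    and b_add_left: "\<lbrakk>v \<in> V; v' \<in> V; w \<in> W\<rbrakk> \<Longrightarrow> b (v + v') w = b v w + b v' w"
    and b_add_right: "\<lbrakk>v \<in> V; w \<in> W; w' \<in> W\<rbrakk> \<Longrightarrow> b v (w + w') = b v w + b v w'"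
    and b_scale_left: "\<lbrakk>v \<in> V; w \<in> W\<rbrakk> \<Longrightarrow> b (scaleV a v) w = a * b v w"
    and b_scale_right: "\<lbrakk>v \<in> V; w \<in> W\<rbrakk> \<Longrightarrow> b v (scaleW a w) = a * b v w"
    and e\<^sub>0: "e\<^sub>0 \<in> FV 0"
    and br_euler: "v \<in> FV n \<Longrightarrow> br e\<^sub>0 v - scaleV (of_int n) v \<in> FV (n + 1)"
    and act_euler: "w \<in> FW n \<Longrightarrow> act e\<^sub>0 w - scaleW (of_int n + 1/2) w \<in> FW (n + 1)"
    and jacobi: "\<lbrakk>v \<in> V; w \<in> W\<rbrakk> \<Longrightarrow> act (br e\<^sub>0 v) w = act e\<^sub>0 (act v w) - act v (act e\<^sub>0 w)"
    and b_cocycle: "\<lbrakk>v \<in> V; w \<in> W\<rbrakk> \<Longrightarrow> b (br e\<^sub>0 v) w = b e\<^sub>0 (act v w) - b v (act e\<^sub>0 w)"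
    and b_bounded: "\<lbrakk>v \<in> FV n; w \<in> FW m; R \<le> n + m\<rbrakk> \<Longrightarrow> b v w = 0"
begin

lemma FW_antimono: "n \<le> m \<Longrightarrow> FW m \<subseteq> FW n"
  by (induction m rule: int_ge_induct) (use FW_Suc in blast)+

lemma e\<^sub>0_V: "e\<^sub>0 \<in> V"
  using e\<^sub>0 FV_subset by blast

lemma act_closed: "\<lbrakk>v \<in> V; w \<in> W\<rbrakk> \<Longrightarrow> act v w \<in> W"
  using FV_exhaust[of v] FW_exhaust[of w] act_filtration FW_subset by blast

lemma weight_nonzero: "(of_int n + 1/2 :: complex) \<noteq> 0"
proof
  assume "(of_int n + 1/2 :: complex) = 0"
  then have "of_int (2 * n + 1) = (0 :: complex)"
    by (simp add: field_simps)
  then have "2 * n + 1 = 0"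
    by (metis of_int_eq_0_iff)
  then show False by presburger
qed

text \<open>
  Dividing by the nonzero weight inverts \<open>e\<^sub>0\<close> on a graded piece; the error lies one step deeper and
  is treated in the same way until the step \<open>R\<close> is reached.
\<close>
lemma euler_approx_surj:
  assumes "w \<in> FW m"
  shows "\<exists>u\<in>W. w - act e\<^sub>0 u \<in> FW R"
  using assms
proof (induction "nat (R - m)" arbitrary: m w rule: less_induct)
  case less
  show ?case
  proof (cases "R \<le> m")
    case True
    with less.prems have "w \<in> FW R" using FW_antimono by blast
    moreover have "0 \<in> W" "act e\<^sub>0 0 = 0"
      using W.subspace_0[OF subspace_W] act_add_right[OF e\<^sub>0_V, of 0 0] by auto
    ultimately show ?thesis by (intro bexI[of _ 0]) auto
  next
    case False
    define c :: complex where "c = of_int m + 1/2"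
    define u where "u = scaleW (1 / c) w"
    have c: "c \<noteq> 0" using weight_nonzero by (simp add: c_def)
    have u: "u \<in> FW m" using less.prems subspace_FW by (simp add: u_def W.subspace_scale)
    have cu: "scaleW c u = w" using c by (simp add: u_def)
    have "- (act e\<^sub>0 u - scaleW c u) \<in> FW (m + 1)"
      unfolding c_def by (intro W.subspace_neg[OF subspace_FW] act_euler[OF u])
    then have "w - act e\<^sub>0 u \<in> FW (m + 1)" by (simp add: cu)
    moreover have "nat (R - (m + 1)) < nat (R - m)" using False by simp
    ultimately obtain u' where u': "u' \<in> W" "w - act e\<^sub>0 u - act e\<^sub>0 u' \<in> FW R"
      using less.hyps by blast
    have "u \<in> W" using u FW_subset by blast
    then have "w - act e\<^sub>0 (u + u') \<in> FW R" "u + u' \<in> W"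
      using u' act_add_right[OF e\<^sub>0_V] W.subspace_add[OF subspace_W] by (auto simp: diff_diff_eq)
    then show ?thesis by blast
  qed
qed

text \<open>
  Injectivity of \<open>e\<^sub>0\<close> on the graded pieces: if \<open>e\<^sub>0\<close> moves \<open>w\<close> into the next step, then so does
  multiplication by its nonzero weight, and \<open>w\<close> was there already.
\<close>
lemma euler_reflects_filtration:
  assumes "w \<in> FW m" "act e\<^sub>0 w \<in> FW R"
  shows "w \<in> FW R"
  using assms(1)
proof (induction "nat (R - m)" arbitrary: m rule: less_induct)
  case less
  show ?case
  proof (cases "R \<le> m")
    case True
    with less.prems show ?thesis using FW_antimono by blast
  next
    case False
    define c :: complex where "c = of_int m + 1/2"
    have c: "c \<noteq> 0" using weight_nonzero by (simp add: c_def)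
    have "act e\<^sub>0 w \<in> FW (m + 1)"
      using assms(2) False FW_antimono[of "m + 1" R] by auto
    then have "act e\<^sub>0 w - (act e\<^sub>0 w - scaleW c w) \<in> FW (m + 1)"
      unfolding c_def by (rule W.subspace_diff[OF subspace_FW _ act_euler[OF less.prems]])
    then have "scaleW c w \<in> FW (m + 1)" by simp
    from W.subspace_scale[OF subspace_FW this, of "1 / c"]
    have "w \<in> FW (m + 1)" using c by simp
    moreover have "nat (R - (m + 1)) < nat (R - m)" using False by simp
    ultimately show ?thesis using less.hyps by blast
  qed
qed

text \<open>The functional forced by \<open>potential (act e\<^sub>0 u) = b e\<^sub>0 u\<close> and vanishing on \<open>FW R\<close>.\<close>
definition potential :: "'w \<Rightarrow> complex" where
  "potential w = b e\<^sub>0 (SOME u. u \<in> W \<and> w - act e\<^sub>0 u \<in> FW R)"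

text \<open>
  Two choices of \<open>u\<close> differ by an element \<open>d\<close> with \<open>act e\<^sub>0 d \<in> FW R\<close>, hence \<open>d \<in> FW R\<close>, where
  \<open>b e\<^sub>0\<close> vanishes by boundedness.
\<close>
lemma potential_eqI:
  assumes w: "w \<in> W" and u: "u \<in> W" "w - act e\<^sub>0 u \<in> FW R"
  shows "potential w = b e\<^sub>0 u"
proof -
  define u' where "u' = (SOME u. u \<in> W \<and> w - act e\<^sub>0 u \<in> FW R)"
  have u': "u' \<in> W" "w - act e\<^sub>0 u' \<in> FW R"
    unfolding u'_def using someI[of "\<lambda>u. u \<in> W \<and> w - act e\<^sub>0 u \<in> FW R" u] u by auto
  define d where "d = u' - u"
  have d: "d \<in> W" using u u' W.subspace_diff[OF subspace_W] by (simp add: d_def)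
  have u'_eq: "u' = u + d" by (simp add: d_def)
  have "act e\<^sub>0 d = (w - act e\<^sub>0 u) - (w - act e\<^sub>0 u')"
    using act_add_right[OF e\<^sub>0_V u(1) d] by (simp add: u'_eq)
  also have "\<dots> \<in> FW R" using u u' W.subspace_diff[OF subspace_FW] by blast
  finally have "d \<in> FW R"
    using euler_reflects_filtration FW_exhaust[OF d] by blast
  then have "b e\<^sub>0 d = 0" using b_bounded[OF e\<^sub>0] by simp
  then have "b e\<^sub>0 u' = b e\<^sub>0 u" using b_add_right[OF e\<^sub>0_V u(1) d] by (simp add: u'_eq)
  then show ?thesis by (simp add: potential_def u'_def)
qed

lemma potential_witness:
  assumes "w \<in> W"
  obtains u where "u \<in> W" "w - act e\<^sub>0 u \<in> FW R" "potential w = b e\<^sub>0 u"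
proof -
  obtain m where "w \<in> FW m" using FW_exhaust[OF assms] by blast
  then obtain u where "u \<in> W" "w - act e\<^sub>0 u \<in> FW R" using euler_approx_surj by blast
  with that potential_eqI[OF assms] show ?thesis by blast
qed

lemma potential_add:
  assumes "w \<in> W" "w' \<in> W"
  shows "potential (w + w') = potential w + potential w'"
proof -
  obtain u where u: "u \<in> W" "w - act e\<^sub>0 u \<in> FW R" "potential w = b e\<^sub>0 u"
    using potential_witness[OF assms(1)] .
  obtain u' where u': "u' \<in> W" "w' - act e\<^sub>0 u' \<in> FW R" "potential w' = b e\<^sub>0 u'"
    using potential_witness[OF assms(2)] .
  have "w + w' - act e\<^sub>0 (u + u') = (w - act e\<^sub>0 u) + (w' - act e\<^sub>0 u')"
    using act_add_right[OF e\<^sub>0_V u(1) u'(1)] by simp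
  also have "\<dots> \<in> FW R" using u u' W.subspace_add[OF subspace_FW] by blast
  finally have "potential (w + w') = b e\<^sub>0 (u + u')"
    using assms u u' W.subspace_add[OF subspace_W] by (intro potential_eqI) auto
  then show ?thesis using b_add_right[OF e\<^sub>0_V u(1) u'(1)] u u' by simp
qed

lemma potential_scale:
  assumes "w \<in> W"
  shows "potential (scaleW a w) = a * potential w"
proof -
  obtain u where u: "u \<in> W" "w - act e\<^sub>0 u \<in> FW R" "potential w = b e\<^sub>0 u"
    using potential_witness[OF assms(1)] .
  have "scaleW a w - act e\<^sub>0 (scaleW a u) = scaleW a (w - act e\<^sub>0 u)"
    using act_scale_right[OF e\<^sub>0_V u(1)] by (simp add: W.scale_right_diff_distrib)
  also have "\<dots> \<in> FW R" using u W.subspace_scale[OF subspace_FW] by blast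
  finally have "potential (scaleW a w) = b e\<^sub>0 (scaleW a u)"
    using assms u W.subspace_scale[OF subspace_W] by (intro potential_eqI) auto
  then show ?thesis using b_scale_right[OF e\<^sub>0_V u(1)] u by simp
qed

lemma potential_zero:
  assumes "w \<in> FW R"
  shows "potential w = 0"
proof -
  have 0: "0 \<in> W" "act e\<^sub>0 0 = 0" "b e\<^sub>0 0 = 0"
    using W.subspace_0[OF subspace_W] act_add_right[OF e\<^sub>0_V, of 0 0] b_add_right[OF e\<^sub>0_V, of 0 0]
    by auto
  then have "potential w = b e\<^sub>0 0"
    using assms FW_subset by (intro potential_eqI) auto
  with 0 show ?thesis by simp
qed

lemma potential_euler:
  assumes "w \<in> W"
  shows "potential (act e\<^sub>0 w) = b e\<^sub>0 w"
  using assms act_closed[OF e\<^sub>0_V assms] W.subspace_0[OF subspace_FW]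
  by (intro potential_eqI) auto

definition defect :: "'v \<Rightarrow> 'w \<Rightarrow> complex" where
  "defect v w = b v w - potential (act v w)"

lemma defect_add_left:
  "\<lbrakk>v \<in> V; v' \<in> V; w \<in> W\<rbrakk> \<Longrightarrow> defect (v + v') w = defect v w + defect v' w"
  by (simp add: defect_def b_add_left act_add_left potential_add act_closed)

lemma defect_add_right:
  "\<lbrakk>v \<in> V; w \<in> W; w' \<in> W\<rbrakk> \<Longrightarrow> defect v (w + w') = defect v w + defect v w'"
  by (simp add: defect_def b_add_right act_add_right potential_add act_closed)

lemma defect_scale_left:
  "\<lbrakk>v \<in> V; w \<in> W\<rbrakk> \<Longrightarrow> defect (scaleV a v) w = a * defect v w"
  by (simp add: defect_def b_scale_left act_scale_left potential_scale act_closed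
      right_diff_distrib)

lemma defect_scale_right:
  "\<lbrakk>v \<in> V; w \<in> W\<rbrakk> \<Longrightarrow> defect v (scaleW a w) = a * defect v w"
  by (simp add: defect_def b_scale_right act_scale_right potential_scale act_closed
      right_diff_distrib)

lemma potential_diff:
  assumes "w \<in> W" "w' \<in> W"
  shows "potential (w - w') = potential w - potential w'"
  using potential_add[of "w - w'" w'] assms W.subspace_diff[OF subspace_W] by simp

text \<open>The term \<open>defect e\<^sub>0 (act v w)\<close> of the cocycle identity vanishes by the choice of \<open>potential\<close>.\<close>
lemma defect_euler_invariant:
  assumes v: "v \<in> V" and w: "w \<in> W"
  shows "defect (br e\<^sub>0 v) w + defect v (act e\<^sub>0 w) = 0"
proof -
  have "act e\<^sub>0 (act v w) \<in> W" "act v (act e\<^sub>0 w) \<in> W"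
    using v w e\<^sub>0_V act_closed by auto
  then show ?thesis
    using v w by (simp add: defect_def b_cocycle jacobi potential_diff potential_euler act_closed)
qed

text \<open>
  Invariance under \<open>e\<^sub>0\<close> multiplies the value by the total weight \<open>n + m + 1/2 \<noteq> 0\<close>, up to values on
  pairs of total index \<open>n + m + 1\<close>, which vanish by induction.
\<close>
lemma defect_eq_0_filtered:
  assumes "v \<in> FV n" "w \<in> FW m"
  shows "defect v w = 0"
  using assms
proof (induction "nat (R - (n + m))" arbitrary: n m v w rule: less_induct)
  case less
  show ?case
  proof (cases "R \<le> n + m")
    case True
    then have "act v w \<in> FW R"
      using act_filtration[OF less.prems] FW_antimono by blast
    then show ?thesis
      using b_bounded[OF less.prems True] by (simp add: defect_def potential_zero)
  next
    case False
    define v' where "v' = br e\<^sub>0 v - scaleV (of_int n) v"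
    define w' where "w' = act e\<^sub>0 w - scaleW (of_int m + 1/2) w"
    have v': "v' \<in> FV (n + 1)" and w': "w' \<in> FW (m + 1)"
      using br_euler act_euler less.prems by (auto simp: v'_def w'_def)
    have mem: "v \<in> V" "w \<in> W" "v' \<in> V" "w' \<in> W"
        "scaleV (of_int n) v \<in> V" "scaleW (of_int m + 1/2) w \<in> W"
      using v' w' less.prems FV_subset FW_subset V.subspace_scale[OF subspace_V]
        W.subspace_scale[OF subspace_W] by blast+
    have smaller: "nat (R - (n + 1 + m)) < nat (R - (n + m))"
        "nat (R - (n + (m + 1))) < nat (R - (n + m))"
      using False by auto
    have "defect v' w = 0" "defect v w' = 0"
      using less.hyps[OF smaller(1) v' less.prems(2)] less.hyps[OF smaller(2) less.prems(1) w']
      by auto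
    moreover have "br e\<^sub>0 v = scaleV (of_int n) v + v'" "act e\<^sub>0 w = scaleW (of_int m + 1/2) w + w'"
      by (simp_all add: v'_def w'_def)
    ultimately have "of_int n * defect v w + (of_int m + 1/2) * defect v w = 0"
      using defect_euler_invariant[OF mem(1,2)] mem
      by (simp add: defect_add_left defect_add_right defect_scale_left defect_scale_right)
    then have "(of_int (n + m) + 1/2) * defect v w = 0"
      by (simp add: algebra_simps)
    then show ?thesis using weight_nonzero[of "n + m"] by simp
  qed
qed

lemma is_coboundary:
  "\<lbrakk>v \<in> V; w \<in> W\<rbrakk> \<Longrightarrow> b v w = potential (act v w)"
  using defect_eq_0_filtered FV_exhaust FW_exhaust by (fastforce simp: defect_def)

end

section \<open>Orders of formal Laurent series\<close>

text \<open>
  A bound on the order that the zero series satisfies for every \<open>d\<close>, whereas \<open>fls_subdegree 0 = 0\<close>.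
\<close>

definition vanishes_below :: "int \<Rightarrow> complex fls \<Rightarrow> bool" where
  "vanishes_below d F \<longleftrightarrow> (\<forall>n<d. fls_nth F n = 0)"

lemma vanishes_below_mult:
  assumes "vanishes_below a F" "vanishes_below b G"
  shows "vanishes_below (a + b) (F * G)"
proof (cases "F = 0 \<or> G = 0")
  case True
  then show ?thesis by (auto simp: vanishes_below_def)
next
  case False
  then have "a \<le> fls_subdegree F" "b \<le> fls_subdegree G"
    using assms by (auto simp: vanishes_below_def intro: fls_subdegree_geI)
  then show ?thesis by (auto simp: vanishes_below_def intro!: fls_times_nth_eq0)
qed

lemma vanishes_below_lie:
  assumes E: "vanishes_below a E" and F: "vanishes_below b F"
  shows "vanishes_below (a + b - 1) (E * fls_deriv F + fls_const \<mu> * (F * fls_deriv E))"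
proof -
  have "vanishes_below (b - 1) (fls_deriv F)" "vanishes_below (a - 1) (fls_deriv E)"
    using E F by (auto simp: vanishes_below_def)
  from vanishes_below_mult[OF E this(1)] vanishes_below_mult[OF F this(2)]
  show ?thesis by (simp add: vanishes_below_def add.commute diff_add_eq add_diff_eq)
qed

text \<open>
  For \<open>E = z\<close> the expression is \<open>\<Sum>n. (n - d) F\<^sub>n z\<^sup>n\<close>, in which the term of degree \<open>d\<close> cancels; the
  remaining part of \<open>E\<close> has order at least \<open>2\<close> and raises the order of \<open>F\<close>.
\<close>
lemma vanishes_below_euler:
  assumes E: "vanishes_below 2 (E - fls_X)" and F: "vanishes_below d F"
  shows "vanishes_below (d + 1) (E * fls_deriv F + fls_const \<mu> * (F * fls_deriv E)
           - fls_const (of_int d + \<mu>) * F)"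
proof -
  define H where "H = E - fls_X"
  have E_eq: "E = fls_X + H" by (simp add: H_def)
  have X: "vanishes_below (d + 1) (fls_X * fls_deriv F - fls_const (of_int d) * F)"
    using F by (auto simp: vanishes_below_def fls_X_times_conv_shift)
  have "vanishes_below (2 + d - 1) (H * fls_deriv F + fls_const \<mu> * (F * fls_deriv H))"
    using vanishes_below_lie[OF E F] by (simp add: H_def)
  moreover have "E * fls_deriv F + fls_const \<mu> * (F * fls_deriv E) - fls_const (of_int d + \<mu>) * F
     = (fls_X * fls_deriv F - fls_const (of_int d) * F)
       + (H * fls_deriv F + fls_const \<mu> * (F * fls_deriv H))"
    by (simp add: E_eq algebra_simps flip: fls_plus_const)
  ultimately show ?thesis using X by (simp add: vanishes_below_def add.commute)
qed

text \<open>
  The product \<open>w powi (-d) * g w\<close> tends to \<open>1\<close>, so it has no pole and its expansion has constant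
  coefficient \<open>1\<close>.
\<close>
lemma laurent_leading_term:
  assumes G: "g has_laurent_expansion G"
    and u: "u \<in> O[at 0](\<lambda>w. w)"
    and g: "\<forall>\<^sub>F w in at 0. g w = w powi d * (1 + u w)"
  shows "vanishes_below d G" and "fls_nth G d = 1"
proof -
  define H where "H = fls_X_intpow (-d) * G"
  have H_nth: "fls_nth H n = fls_nth G (n + d)" for n
    unfolding H_def fls_X_intpow_times_conv_shift by simp
  have "(\<lambda>w. w powi (-d) * g w) has_laurent_expansion H"
    unfolding H_def by (intro laurent_expansion_intros G)
  moreover have "\<forall>\<^sub>F w in at 0. w powi (-d) * g w = 1 + u w"
    using g eventually_neq_at_within[of 0 0 UNIV]
    by eventually_elim (simp add: power_int_minus field_simps)
  ultimately have H: "(\<lambda>w. 1 + u w) has_laurent_expansion H"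
    by (simp add: has_laurent_expansion_cong)
  obtain C where "\<forall>\<^sub>F w in at 0. norm (u w) \<le> C * norm (w :: complex)"
    using u by (elim landau_o.bigE)
  moreover have "((\<lambda>w. C * norm (w :: complex)) \<longlongrightarrow> 0) (at 0)"
    by (auto intro!: tendsto_eq_intros)
  ultimately have "(u \<longlongrightarrow> 0) (at 0)"
    by (rule Lim_null_comparison)
  then have lim: "((\<lambda>w. 1 + u w) \<longlongrightarrow> 1) (at 0)"
    by (auto intro!: tendsto_eq_intros)
  have sub: "fls_subdegree H \<ge> 0"
  proof (rule ccontr)
    assume "\<not> fls_subdegree H \<ge> 0"
    then have "filterlim (\<lambda>w. 1 + u w) at_infinity (at 0)"
      using has_laurent_expansion_imp_filterlim_infinity_0[OF H] by simp
    with lim show False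
      using not_tendsto_and_filterlim_at_infinity trivial_limit_at by blast
  qed
  then have "((\<lambda>w. 1 + u w) \<longlongrightarrow> fls_nth H 0) (at 0)"
    by (rule has_laurent_expansion_imp_tendsto_0[OF H])
  with lim have "fls_nth H 0 = 1"
    using tendsto_unique trivial_limit_at by blast
  then show "fls_nth G d = 1" by (simp add: H_nth)
  show "vanishes_below d G"
    unfolding vanishes_below_def
  proof (intro allI impI)
    fix n assume "n < d"
    then have "fls_nth H (n - d) = 0" using sub by auto
    then show "fls_nth G n = 0" by (simp add: H_nth)
  qed
qed

section \<open>Lie derivatives of meromorphic sections\<close>

text \<open>
  The Lie derivative of a section \<open>t\<close> of weight \<open>\<mu>\<close> along a vector field \<open>e\<close>. For \<open>\<mu> = -1\<close> it is
  the bracket of vector fields and for \<open>\<mu> = -1/2\<close> the action on the odd part, so that both are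
  treated at once.
\<close>

definition lie_derivative :: "real \<Rightarrow> 'i sec \<Rightarrow> 'i sec \<Rightarrow> 'i sec" where
  "lie_derivative \<mu> e t =
     (\<lambda>i w. e i w * deriv (t i) w + of_real \<mu> * (t i w * deriv (e i) w))"

lemma vf_bracket_eq_lie: "vf_bracket e f = lie_derivative (-1) e f"
  by (simp add: vf_bracket_def lie_derivative_def fun_eq_iff)

lemma vf_action_eq_lie: "vf_action e \<phi> = lie_derivative (-1/2) e \<phi>"
  by (simp add: vf_action_def lie_derivative_def fun_eq_iff)

locale punctured_surface =
  fixes X :: "('i, 'a::t2_space) surface_atlas"
    and L :: "'i \<Rightarrow> 'i \<Rightarrow> 'a \<Rightarrow> complex"
    and A :: "'a set"
  assumes surface: "compact_riemann_surface X"
    and theta: "theta_characteristic X L"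
    and finite_A: "finite A"
begin

abbreviation punctured_chart :: "'i \<Rightarrow> complex set" where
  "punctured_chart i \<equiv> chart X i ` (patch X i - A)"

lemma open_patch: "open (patch X i)"
  and open_chart_image: "open (chart X i ` patch X i)"
  and homeomorphism_chart:
    "homeomorphism (patch X i) (chart X i ` patch X i) (chart X i) (chart_inv X i)"
  using surface unfolding compact_riemann_surface_def by blast+

lemma chart_inv_chart [simp]: "p \<in> patch X i \<Longrightarrow> chart_inv X i (chart X i p) = p"
  using homeomorphism_chart by (auto simp: homeomorphism_def)

lemma open_chart_image_subset:
  assumes "open S"
  shows "open (chart X i ` (patch X i \<inter> S))"
proof -
  have "openin (top_of_set (chart X i ` patch X i)) (chart X i ` (patch X i \<inter> S))"
    using homeomorphism_imp_open_map[OF homeomorphism_chart] assms by auto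
  then show ?thesis
    using open_chart_image openin_open_eq by blast
qed

lemma open_minus_A: "open (- A)"
  using finite_A finite_imp_closed by blast

lemma open_punctured_chart: "open (punctured_chart i)"
  using open_chart_image_subset[OF open_minus_A, of i] by (simp add: Diff_eq)

lemma transition_holomorphic:
  "(chart X j \<circ> chart_inv X i) holomorphic_on chart X i ` (patch X i \<inter> patch X j)"
  using surface unfolding compact_riemann_surface_def by blast

lemma bundle_holomorphic:
  "(L i j \<circ> chart_inv X i) holomorphic_on chart X i ` (patch X i \<inter> patch X j)"
  using theta unfolding theta_characteristic_def line_bundle_def by blast

lemma bundle_nonzero: "\<lbrakk>p \<in> patch X i; p \<in> patch X j\<rbrakk> \<Longrightarrow> L i j p \<noteq> 0"
  using theta unfolding theta_characteristic_def line_bundle_def by blast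

lemma deriv_transition:
  "\<lbrakk>p \<in> patch X i; p \<in> patch X j\<rbrakk> \<Longrightarrow> deriv (chart X j \<circ> chart_inv X i) (chart X i p) = (L i j p)\<^sup>2"
  using theta unfolding theta_characteristic_def canonical_bundle_def by (metis IntI)

lemma
  assumes "s \<in> F_space X L A lam"
  shows F_space_meromorphic: "s i meromorphic_on chart X i ` patch X i"
    and F_space_holomorphic: "s i holomorphic_on punctured_chart i"
    and F_space_zero: "w \<notin> punctured_chart i \<Longrightarrow> s i w = 0"
    and F_space_transition: "\<lbrakk>p \<in> patch X i; p \<in> patch X j; p \<notin> A\<rbrakk> \<Longrightarrow>
           s i (chart X i p) = L i j p powi \<lfloor>2 * lam\<rfloor> * s j (chart X j p)"
  using assms unfolding F_space_def meromorphic_sections_def K_power_def by blast+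

lemma F_space_has_derivative:
  assumes "s \<in> F_space X L A lam" "w \<in> punctured_chart i"
  shows "(s i has_field_derivative deriv (s i) w) (at w)"
    and "(deriv (s i) has_field_derivative deriv (deriv (s i)) w) (at w)"
  using holomorphic_derivI[OF _ open_punctured_chart assms(2)]
    F_space_holomorphic[OF assms(1)] holomorphic_deriv[OF _ open_punctured_chart]
  by blast+

lemma F_spaceI:
  assumes "\<And>i. s i meromorphic_on chart X i ` patch X i"
    and "\<And>i. s i holomorphic_on punctured_chart i"
    and "\<And>i w. w \<notin> punctured_chart i \<Longrightarrow> s i w = 0"
    and "\<And>i j p. \<lbrakk>p \<in> patch X i; p \<in> patch X j; p \<notin> A\<rbrakk> \<Longrightarrow>
           s i (chart X i p) = L i j p powi \<lfloor>2 * lam\<rfloor> * s j (chart X j p)"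
  shows "s \<in> F_space X L A lam"
  using assms unfolding F_space_def meromorphic_sections_def K_power_def by blast

lemma subspace_F_space: "sec.subspace (F_space X L A lam)"
proof (rule sec.subspaceI)
  show "0 \<in> F_space X L A lam"
    by (rule F_spaceI) (simp_all add: zero_fun_def meromorphic_on_const)
next
  fix s t assume st: "s \<in> F_space X L A lam" "t \<in> F_space X L A lam"
  show "s + t \<in> F_space X L A lam"
  proof (rule F_spaceI)
    fix i
    show "(s + t) i meromorphic_on chart X i ` patch X i"
      unfolding plus_fun_def using st[THEN F_space_meromorphic] by (rule meromorphic_on_add)
    show "(s + t) i holomorphic_on punctured_chart i"
      unfolding plus_fun_def using st[THEN F_space_holomorphic] by (rule holomorphic_on_add)
    show "(s + t) i w = 0" if "w \<notin> punctured_chart i" for w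
      using F_space_zero[OF st(1) that] F_space_zero[OF st(2) that] by simp
    show "(s + t) i (chart X i p) = L i j p powi \<lfloor>2 * lam\<rfloor> * (s + t) j (chart X j p)"
      if "p \<in> patch X i" "p \<in> patch X j" "p \<notin> A" for j p
      by (simp only: plus_fun_apply F_space_transition[OF st(1) that] F_space_transition[OF st(2) that]
          distrib_left)
  qed
next
  fix a s assume s: "s \<in> F_space X L A lam"
  show "sec_scale a s \<in> F_space X L A lam"
  proof (rule F_spaceI)
    fix i
    show "sec_scale a s i meromorphic_on chart X i ` patch X i"
      unfolding sec_scale_def by (rule meromorphic_on_mult[OF meromorphic_on_const F_space_meromorphic[OF s]])
    show "sec_scale a s i holomorphic_on punctured_chart i"
      unfolding sec_scale_def by (rule holomorphic_on_mult[OF holomorphic_on_const F_space_holomorphic[OF s]])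
    show "sec_scale a s i w = 0" if "w \<notin> punctured_chart i" for w
      using F_space_zero[OF s that] by (simp add: sec_scale_def)
    show "sec_scale a s i (chart X i p) = L i j p powi \<lfloor>2 * lam\<rfloor> * sec_scale a s j (chart X j p)"
      if "p \<in> patch X i" "p \<in> patch X j" "p \<notin> A" for j p
      by (simp only: sec_scale_def F_space_transition[OF s that] mult.left_commute)
  qed
qed

text \<open>
  Differentiation of \<open>s\<^sub>i = l\<^sup>k (s\<^sub>j \<circ> \<tau>)\<close>, where the coordinate change \<open>\<tau>\<close> has derivative \<open>l\<^sup>2\<close>
  because \<open>L\<close> squares to the canonical bundle.
\<close>
lemma deriv_F_space_transition:
  assumes s: "s \<in> F_space X L A lam"
    and p: "p \<in> patch X i" "p \<in> patch X j" "p \<notin> A"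
  defines "k \<equiv> \<lfloor>2 * lam\<rfloor>" and "l \<equiv> L i j p"
    and "dl \<equiv> deriv (L i j \<circ> chart_inv X i) (chart X i p)"
  shows "deriv (s i) (chart X i p) =
           of_int k * l powi (k - 1) * dl * s j (chart X j p)
           + l powi k * (deriv (s j) (chart X j p) * l\<^sup>2)"
proof -
  define g where "g = L i j \<circ> chart_inv X i"
  define \<tau> where "\<tau> = chart X j \<circ> chart_inv X i"
  define N where "N = chart X i ` (patch X i \<inter> (patch X j \<inter> - A))"
  define w where "w = chart X i p"
  have N: "open N" "w \<in> N"
    unfolding N_def w_def using p open_patch open_minus_A by (auto intro!: open_chart_image_subset)
  have sub: "N \<subseteq> chart X i ` (patch X i \<inter> patch X j)"
    by (auto simp: N_def)
  have g: "(g has_field_derivative dl) (at w)"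
    unfolding dl_def g_def w_def[symmetric]
    by (rule holomorphic_derivI[OF holomorphic_on_subset[OF bundle_holomorphic sub] N])
  have gw: "g w = l" and l: "l \<noteq> 0"
    using p bundle_nonzero by (simp_all add: g_def w_def l_def)
  have "(\<tau> has_field_derivative deriv \<tau> w) (at w)"
    unfolding \<tau>_def
    by (rule holomorphic_derivI[OF holomorphic_on_subset[OF transition_holomorphic sub] N])
  moreover have "deriv \<tau> w = l\<^sup>2"
    unfolding \<tau>_def w_def l_def using p(1,2) by (rule deriv_transition)
  ultimately have \<tau>: "(\<tau> has_field_derivative l\<^sup>2) (at w)"
    by simp
  have \<tau>w: "\<tau> w = chart X j p"
    using p by (simp add: \<tau>_def w_def)
  have sj: "(s j has_field_derivative deriv (s j) (chart X j p)) (at (\<tau> w))"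
    unfolding \<tau>w by (rule F_space_has_derivative[OF s]) (use p in blast)
  have "((\<lambda>v. g v powi k * s j (\<tau> v)) has_field_derivative
      of_int k * l powi (k - 1) * dl * s j (chart X j p)
           + l powi k * (deriv (s j) (chart X j p) * l\<^sup>2)) (at w)"
  proof (rule DERIV_cong[OF DERIV_mult[OF DERIV_power_int[OF g] DERIV_chain2[OF sj \<tau>]]])
    show "0 \<le> k \<or> g w \<noteq> 0" using gw l by simp
  qed (simp only: gw \<tau>w mult.commute)
  moreover have "g v powi k * s j (\<tau> v) = s i v" if "v \<in> N" for v
  proof -
    obtain q where "q \<in> patch X i" "q \<in> patch X j" "q \<notin> A" "v = chart X i q"
      using \<open>v \<in> N\<close> unfolding N_def by blast
    then show ?thesis
      using F_space_transition[OF s, of q i j] by (simp add: g_def \<tau>_def k_def)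
  qed
  ultimately have "(s i has_field_derivative of_int k * l powi (k - 1) * dl * s j (chart X j p)
           + l powi k * (deriv (s j) (chart X j p) * l\<^sup>2)) (at w)"
    by (rule has_field_derivative_transform_within_open[OF _ N])
  then show ?thesis unfolding w_def by (rule DERIV_imp_deriv)
qed

text \<open>
  The derivative of the transition function enters the two summands with the factors \<open>2 \<mu>\<close> and
  \<open>- 2 \<mu>\<close>, by \<open>deriv_F_space_transition\<close> for \<open>k = 2 \<mu>\<close> and for \<open>k = - 2\<close>; it cancels, so that Lie
  derivatives transform like sections.
\<close>
lemma lie_derivative_closed:
  assumes e: "e \<in> F_space X L A (-1)" and t: "t \<in> F_space X L A \<mu>" and \<mu>: "2 * \<mu> \<in> \<int>"
  shows "lie_derivative \<mu> e t \<in> F_space X L A \<mu>"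
proof -
  define k where "k = \<lfloor>2 * \<mu>\<rfloor>"
  have "of_int k = 2 * \<mu>" using \<mu> by (simp add: k_def)
  then have "complex_of_real (of_int k) = complex_of_real (2 * \<mu>)" by presburger
  then have k_eq: "complex_of_int k = 2 * of_real \<mu>" by simp
  have trans: "lie_derivative \<mu> e t i (chart X i p) =
      L i j p powi k * lie_derivative \<mu> e t j (chart X j p)"
    if p: "p \<in> patch X i" "p \<in> patch X j" "p \<notin> A" for i j p
  proof -
    define l where "l = L i j p"
    have l: "l \<noteq> 0" using bundle_nonzero p by (simp add: l_def)
    define r where "r = inverse l"
    have powers: "l powi (k - 1) = l powi k * r" "l powi (-2) = r\<^sup>2" "l powi (-2 - 1) = r ^ 3"
      using l by (simp_all add: r_def power_int_diff power_int_minus divide_inverse power_inverse)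
    have rl: "r\<^sup>2 * l\<^sup>2 = 1"
      using l by (simp add: r_def flip: power_mult_distrib)
    have floor: "\<lfloor>2 * (- 1) :: real\<rfloor> = -2" by simp
    define h where "h = complex_of_real \<mu>"
    define q where "q = l powi k"
    define dl where "dl = deriv (L i j \<circ> chart_inv X i) (chart X i p)"
    define ej where "ej = e j (chart X j p)"
    define dej where "dej = deriv (e j) (chart X j p)"
    define tj where "tj = t j (chart X j p)"
    define dtj where "dtj = deriv (t j) (chart X j p)"
    have ei: "e i (chart X i p) = r\<^sup>2 * ej"
      using F_space_transition[OF e p] by (simp only: floor powers flip: l_def ej_def)
    have dei: "deriv (e i) (chart X i p) = of_int (- 2) * r ^ 3 * dl * ej + r\<^sup>2 * (dej * l\<^sup>2)"
      using deriv_F_space_transition[OF e p]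
      by (simp only: floor powers flip: l_def ej_def dej_def dl_def)
    have ti: "t i (chart X i p) = q * tj"
      using F_space_transition[OF t p] by (simp only: k_def[symmetric] l_def[symmetric] q_def tj_def)
    have dti: "deriv (t i) (chart X i p) = 2 * h * (q * r) * dl * tj + q * (dtj * l\<^sup>2)"
      using deriv_F_space_transition[OF t p]
      by (simp only: powers k_def[symmetric] l_def[symmetric] q_def tj_def dtj_def dl_def k_eq h_def)
    have "r\<^sup>2 * ej * (2 * h * (q * r) * dl * tj + q * (dtj * l\<^sup>2))
        + h * (q * tj * (of_int (- 2) * r ^ 3 * dl * ej + r\<^sup>2 * (dej * l\<^sup>2)))
      = q * (ej * dtj + h * (tj * dej)) * (r\<^sup>2 * l\<^sup>2)"
      by (simp add: power2_eq_square power3_eq_cube algebra_simps)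
    then show ?thesis
      unfolding rl
      by (simp add: lie_derivative_def ei dei ti dti
          flip: q_def ej_def dej_def tj_def dtj_def l_def h_def)
  qed
  have mero: "lie_derivative \<mu> e t i meromorphic_on chart X i ` patch X i" for i
    unfolding lie_derivative_def
    by (intro meromorphic_on_add meromorphic_on_mult meromorphic_on_deriv meromorphic_on_const
        F_space_meromorphic[OF e] F_space_meromorphic[OF t])
  have holo: "lie_derivative \<mu> e t i holomorphic_on punctured_chart i" for i
    unfolding lie_derivative_def
    by (intro holomorphic_on_add holomorphic_on_mult holomorphic_deriv holomorphic_on_const
        F_space_holomorphic[OF e] F_space_holomorphic[OF t] open_punctured_chart)
  have zero: "lie_derivative \<mu> e t i w = 0" if "w \<notin> punctured_chart i" for i w
    using F_space_zero[OF e that] F_space_zero[OF t that] by (simp add: lie_derivative_def)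
  show ?thesis
    by (rule F_spaceI[OF mero holo zero trans[unfolded k_def]])
qed

lemma deriv_lie_derivative:
  assumes e: "e \<in> F_space X L A lam" and t: "t \<in> F_space X L A lam'" and w: "w \<in> punctured_chart i"
  shows "deriv (lie_derivative \<mu> e t i) w =
    deriv (e i) w * deriv (t i) w + e i w * deriv (deriv (t i)) w
    + of_real \<mu> * (deriv (t i) w * deriv (e i) w + t i w * deriv (deriv (e i)) w)"
proof -
  note D = F_space_has_derivative[OF e w] F_space_has_derivative[OF t w]
  show ?thesis
    unfolding lie_derivative_def
    using DERIV_add[OF DERIV_mult[OF D(1) D(4)] DERIV_cmult[OF DERIV_mult[OF D(3) D(2)], of "of_real \<mu>"]]
    by (simp add: DERIV_imp_deriv add_ac mult_ac)
qed

text \<open>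
  A pointwise identity on the punctured charts. At all other points the sections are normalised to
  be zero, and so are the Lie derivatives, whatever values \<open>deriv\<close> takes there.
\<close>
lemma lie_derivative_jacobi:
  assumes e: "e \<in> F_space X L A (-1)" and f: "f \<in> F_space X L A (-1)"
    and t: "t \<in> F_space X L A \<mu>"
  shows "lie_derivative \<mu> (lie_derivative (-1) e f) t =
    lie_derivative \<mu> e (lie_derivative \<mu> f t) - lie_derivative \<mu> f (lie_derivative \<mu> e t)"
proof (intro ext)
  fix i w
  show "lie_derivative \<mu> (lie_derivative (-1) e f) t i w =
    (lie_derivative \<mu> e (lie_derivative \<mu> f t) - lie_derivative \<mu> f (lie_derivative \<mu> e t)) i w"
  proof (cases "w \<in> punctured_chart i")
    case False
    then have "e i w = 0" "f i w = 0" "t i w = 0"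
      using F_space_zero e f t by auto
    then show ?thesis by (simp add: lie_derivative_def)
  next
    case True
    note deriv_lie = deriv_lie_derivative[OF e f True] deriv_lie_derivative[OF e t True]
      deriv_lie_derivative[OF f t True]
    have lie: "lie_derivative \<nu> a s i w =
        a i w * deriv (s i) w + of_real \<nu> * (s i w * deriv (a i) w)" for \<nu> a s
      by (simp add: lie_derivative_def)
    define m where "m = complex_of_real \<mu>"
    define e0 e1 e2 where "e0 = e i w" and "e1 = deriv (e i) w" and "e2 = deriv (deriv (e i)) w"
    define f0 f1 f2 where "f0 = f i w" and "f1 = deriv (f i) w" and "f2 = deriv (deriv (f i)) w"
    define t0 t1 t2 where "t0 = t i w" and "t1 = deriv (t i) w" and "t2 = deriv (deriv (t i)) w"
    note defs = m_def e0_def e1_def e2_def f0_def f1_def f2_def t0_def t1_def t2_def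
    have "(e0 * f1 + -1 * (f0 * e1)) * t1
        + m * (t0 * (e1 * f1 + e0 * f2 + -1 * (f1 * e1 + f0 * e2)))
      = e0 * (f1 * t1 + f0 * t2 + m * (t1 * f1 + t0 * f2)) + m * ((f0 * t1 + m * (t0 * f1)) * e1)
        - (f0 * (e1 * t1 + e0 * t2 + m * (t1 * e1 + t0 * e2)) + m * ((e0 * t1 + m * (t0 * e1)) * f1))"
      by (simp add: algebra_simps)
    then show ?thesis
      by (simp only: lie deriv_lie minus_apply of_real_minus of_real_1 flip: defs)
  qed
qed

lemma
  assumes "e \<in> F_space X L A (-1)" "t \<in> F_space X L A lam"
  shows lie_derivative_add_left:
      "e' \<in> F_space X L A (-1) \<Longrightarrow>
        lie_derivative \<mu> (e + e') t = lie_derivative \<mu> e t + lie_derivative \<mu> e' t"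
    and lie_derivative_add_right:
      "t' \<in> F_space X L A lam \<Longrightarrow>
        lie_derivative \<mu> e (t + t') = lie_derivative \<mu> e t + lie_derivative \<mu> e t'"
    and lie_derivative_scale_left:
      "lie_derivative \<mu> (sec_scale a e) t = sec_scale a (lie_derivative \<mu> e t)"
    and lie_derivative_scale_right:
      "lie_derivative \<mu> e (sec_scale a t) = sec_scale a (lie_derivative \<mu> e t)"
proof -
  have add: "s i w * deriv (u i + u' i) w = s i w * deriv (u i) w + s i w * deriv (u' i) w"
    if "s \<in> F_space X L A \<sigma>" "u \<in> F_space X L A \<rho>" "u' \<in> F_space X L A \<rho>" for s u u' i w \<sigma> \<rho>
  proof (cases "w \<in> punctured_chart i")
    case True
    then have "deriv (u i + u' i) w = deriv (u i) w + deriv (u' i) w"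
      unfolding plus_fun_def
      using DERIV_imp_deriv[OF DERIV_add[OF F_space_has_derivative(1)[OF that(2)]
            F_space_has_derivative(1)[OF that(3)]]] by blast
    then show ?thesis by (simp only: distrib_left)
  next
    case False
    then show ?thesis using F_space_zero[OF that(1)] by simp
  qed
  have scale: "s i w * deriv (\<lambda>v. a * u i v) w = a * (s i w * deriv (u i) w)"
    if "s \<in> F_space X L A \<sigma>" "u \<in> F_space X L A \<rho>" for s u i w \<sigma> \<rho> a
  proof (cases "w \<in> punctured_chart i")
    case True
    then have "deriv (\<lambda>v. a * u i v) w = a * deriv (u i) w"
      using DERIV_imp_deriv[OF DERIV_cmult[OF F_space_has_derivative(1)[OF that(2)]]] by blast
    then show ?thesis by simp
  next
    case False
    then show ?thesis using F_space_zero[OF that(1)] by simp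
  qed
  show "lie_derivative \<mu> (e + e') t = lie_derivative \<mu> e t + lie_derivative \<mu> e' t"
    if "e' \<in> F_space X L A (-1)"
    by (intro ext) (simp add: lie_derivative_def add[OF assms(2,1) that] distrib_left distrib_right)
  show "lie_derivative \<mu> e (t + t') = lie_derivative \<mu> e t + lie_derivative \<mu> e t'"
    if "t' \<in> F_space X L A lam"
    by (intro ext) (simp add: lie_derivative_def add[OF assms that] distrib_left distrib_right)
  show "lie_derivative \<mu> (sec_scale a e) t = sec_scale a (lie_derivative \<mu> e t)"
    by (intro ext, simp only: lie_derivative_def sec_scale_def scale[OF assms(2,1)])
      (simp add: algebra_simps)
  show "lie_derivative \<mu> e (sec_scale a t) = sec_scale a (lie_derivative \<mu> e t)"
    by (intro ext, simp only: lie_derivative_def sec_scale_def scale[OF assms])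
      (simp add: algebra_simps)
qed

end

section \<open>Laurent expansions at the in-points\<close>

locale in_pointed_surface = punctured_surface X L A
  for X :: "('i, 'a::t2_space) surface_atlas"
    and L :: "'i \<Rightarrow> 'i \<Rightarrow> 'a \<Rightarrow> complex"
    and A :: "'a set" +
  fixes K :: nat and P :: "nat \<Rightarrow> 'a" and zc :: "nat \<Rightarrow> 'i"
  assumes coordinates: "p \<in> {1..K} \<Longrightarrow> P p \<in> patch X (zc p) \<and> chart X (zc p) (P p) = 0"
begin

definition germ :: "'i sec \<Rightarrow> nat \<Rightarrow> complex fls" where
  "germ s p = laurent_expansion (s (zc p)) 0"

lemma has_germ:
  assumes "s \<in> F_space X L A lam" "p \<in> {1..K}"
  shows "s (zc p) has_laurent_expansion germ s p"
proof -
  have "0 \<in> chart X (zc p) ` patch X (zc p)"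
    using coordinates[OF assms(2)] by force
  then have "s (zc p) meromorphic_on {0}"
    using F_space_meromorphic[OF assms(1), of "zc p"] by (blast intro: meromorphic_on_subset)
  from meromorphic_on_imp_has_laurent_expansion[OF this, of 0] show ?thesis
    by (simp add: germ_def)
qed

lemma germ_eqI: "s (zc p) has_laurent_expansion G \<Longrightarrow> germ s p = G"
  unfolding germ_def by (rule laurent_expansion_0_eqI)

lemma germ_zero [simp]: "germ 0 p = 0"
  by (rule germ_eqI) (simp add: zero_fun_def)

lemma germ_add:
  assumes "s \<in> F_space X L A lam" "t \<in> F_space X L A lam" "p \<in> {1..K}"
  shows "germ (s + t) p = germ s p + germ t p"
  using has_laurent_expansion_add[OF has_germ[OF assms(1,3)] has_germ[OF assms(2,3)]]
  by (intro germ_eqI) (simp add: plus_fun_def)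

lemma germ_scale:
  assumes "s \<in> F_space X L A lam" "p \<in> {1..K}"
  shows "germ (sec_scale a s) p = fls_const a * germ s p"
  using has_laurent_expansion_cmult_left[OF has_germ[OF assms], of a]
  by (intro germ_eqI) (simp add: sec_scale_def)

lemma germ_diff:
  assumes "s \<in> F_space X L A lam" "t \<in> F_space X L A lam" "p \<in> {1..K}"
  shows "germ (s - t) p = germ s p - germ t p"
  using has_laurent_expansion_diff[OF has_germ[OF assms(1,3)] has_germ[OF assms(2,3)]]
  by (intro germ_eqI) (simp add: fun_diff_def)

lemma germ_lie_derivative:
  assumes "e \<in> F_space X L A lam" "t \<in> F_space X L A lam'" "p \<in> {1..K}"
  shows "germ (lie_derivative \<mu> e t) p =
    germ e p * fls_deriv (germ t p) + fls_const (of_real \<mu>) * (germ t p * fls_deriv (germ e p))"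
  unfolding lie_derivative_def
  by (intro germ_eqI has_laurent_expansion_add has_laurent_expansion_mult
      has_laurent_expansion_cmult_left has_laurent_expansion_deriv
      has_germ[OF assms(1,3)] has_germ[OF assms(2,3)])

lemma germ_sum:
  assumes "finite I" "\<And>i. i \<in> I \<Longrightarrow> s i \<in> F_space X L A lam" "p \<in> {1..K}"
  shows "germ (\<Sum>i\<in>I. s i) p = (\<Sum>i\<in>I. germ (s i) p)"
  using assms(1,2)
proof (induction I rule: finite_induct)
  case (insert i I)
  have "(\<Sum>i\<in>I. s i) \<in> F_space X L A lam"
    using insert.prems by (intro sec.subspace_sum[OF subspace_F_space]) auto
  with insert have "germ (s i + (\<Sum>i\<in>I. s i)) p = germ (s i) p + (\<Sum>i\<in>I. germ (s i) p)"
    by (metis germ_add[OF _ _ assms(3)] insertCI)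
  then show ?case
    unfolding sum.insert[OF insert.hyps(1,2)] .
qed simp

text \<open>
  The order \<open>sec_order\<close> is computed in an arbitrarily chosen chart \<open>j\<close> around the point, the
  expansion in the given one. The transition function is holomorphic and nonzero, and the coordinate
  change has nonzero derivative, so that the order is the same in both. Where \<open>s\<close> vanishes
  identically near the point, \<open>sec_order\<close> carries no information, but then the expansion is zero.
\<close>
lemma vanishes_below_germ_of_sec_order:
  assumes s: "s \<in> F_space X L A lam" and p: "p \<in> {1..K}" and d: "d \<le> sec_order X s (P p)"
  shows "vanishes_below d (germ s p)"
proof (cases "germ s p = 0")
  case True
  then show ?thesis by (simp add: vanishes_below_def)
next
  case False
  define i where "i = zc p"
  define j where "j = (SOME j. P p \<in> patch X j)"
  have Pi: "P p \<in> patch X i" "chart X i (P p) = 0"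
    using coordinates[OF p] by (simp_all add: i_def)
  have Pj: "P p \<in> patch X j"
    unfolding j_def using Pi(1) by (rule someI)
  have d': "d \<le> zorder (s j) (chart X j (P p))"
    using d by (simp add: sec_order_def j_def Let_def)
  define g where "g = L i j \<circ> chart_inv X i"
  define \<tau> where "\<tau> = chart X j \<circ> chart_inv X i"
  define N where "N = chart X i ` (patch X i \<inter> patch X j)"
  have N: "open N" "0 \<in> N"
    using open_chart_image_subset[OF open_patch] Pi Pj by (force simp: N_def)+
  have inv0: "chart_inv X i 0 = P p"
    using chart_inv_chart[OF Pi(1)] Pi(2) by simp
  have \<tau>0: "\<tau> 0 = chart X j (P p)"
    by (simp add: \<tau>_def inv0)
  have "\<tau> holomorphic_on N" "g holomorphic_on N"
    unfolding \<tau>_def g_def N_def by (rule transition_holomorphic bundle_holomorphic)+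
  then have an: "\<tau> analytic_on {0}" "g analytic_on {0}"
    using N by (auto simp: analytic_at)
  have g0: "g 0 \<noteq> 0"
    using bundle_nonzero[OF Pi(1) Pj] by (simp add: g_def inv0)
  have "deriv \<tau> 0 \<noteq> 0"
    using deriv_transition[OF Pi(1) Pj] bundle_nonzero[OF Pi(1) Pj] Pi(2)
    by (simp add: \<tau>_def)
  define h where "h = (\<lambda>w. g w powi \<lfloor>2 * lam\<rfloor>)"
  define H where "H = fps_expansion h 0"
  define T where "T = fps_expansion (\<lambda>w. \<tau> w - \<tau> 0) 0"
  have "h analytic_on {0}"
    unfolding h_def using an(2) g0 by (intro analytic_on_power_int) auto
  then have H: "h has_fps_expansion H"
    unfolding H_def by (rule analytic_at_imp_has_fps_expansion_0)
  have "fps_nth H 0 = g 0 powi \<lfloor>2 * lam\<rfloor>"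
    using has_fps_expansion_imp_0_eq_fps_nth_0[OF H] by (simp add: h_def)
  then have "fps_nth H 0 \<noteq> 0"
    using g0 by (metis power_int_not_zero)
  then have H_sub: "fls_subdegree (fps_to_fls H) = 0" "fps_to_fls H \<noteq> 0"
    by (auto simp: fls_subdegree_fls_to_fps)
  have T: "(\<lambda>w. \<tau> w - \<tau> 0) has_fps_expansion T"
    unfolding T_def
    by (intro analytic_at_imp_has_fps_expansion_0 analytic_intros an(1))
  have T0: "fps_nth T 0 = 0"
    using has_fps_expansion_imp_0_eq_fps_nth_0[OF T] by simp
  have "fps_nth T 1 = deriv \<tau> 0"
    using an(1) by (simp add: T_def fps_expansion_def analytic_on_imp_differentiable_at)
  then have T1: "fps_nth T 1 \<noteq> 0" using \<open>deriv \<tau> 0 \<noteq> 0\<close> by simp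
  then have T_nz: "T \<noteq> 0" by auto
  have T_sub: "subdegree T = 1"
    using T0 T1 by (intro subdegreeI) (auto simp: less_Suc_eq)
  have "chart X j (P p) \<in> chart X j ` patch X j" using Pj by blast
  then have "s j meromorphic_on {\<tau> 0}"
    unfolding \<tau>0 using F_space_meromorphic[OF s, of j] by (blast intro: meromorphic_on_subset)
  then obtain F where F: "(\<lambda>w. s j (\<tau> 0 + w)) has_laurent_expansion F"
    unfolding meromorphic_on_def by blast
  have "((\<lambda>w. s j (\<tau> 0 + w)) \<circ> (\<lambda>w. \<tau> w - \<tau> 0)) has_laurent_expansion fls_compose_fps F T"
    by (rule has_laurent_expansion_compose[OF F has_laurent_expansion_fps[OF T] T0 T_nz])
  then have "(\<lambda>w. h w * s j (\<tau> w)) has_laurent_expansion fps_to_fls H * fls_compose_fps F T"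
    by (intro has_laurent_expansion_mult has_laurent_expansion_fps[OF H]) (simp add: o_def)
  moreover have "\<forall>\<^sub>F w in at 0. h w * s j (\<tau> w) = s i w"
  proof -
    \<comment> \<open>The transition rule holds off \<open>A\<close>; other points of \<open>A\<close> are kept away from \<open>P p\<close>.\<close>
    define S where "S = chart X i ` (patch X i \<inter> (patch X j \<inter> - (A - {P p})))"
    have "finite (A - {P p})" using finite_A by simp
    then have "open S"
      unfolding S_def
      by (intro open_chart_image_subset open_Int open_patch open_Compl finite_imp_closed)
    moreover have "0 \<in> S"
      unfolding S_def using Pi Pj by (intro image_eqI[of _ _ "P p"]) auto
    ultimately have "\<forall>\<^sub>F w in at 0. w \<in> S - {0}"
      by (rule eventually_at_in_open)
    then show ?thesis
    proof eventually_elim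
      case (elim w)
      then obtain q where q: "q \<in> patch X i" "q \<in> patch X j" "q \<notin> A - {P p}" "w = chart X i q" "w \<noteq> 0"
        unfolding S_def by blast
      then have "q \<notin> A" using Pi(2) by auto
      from F_space_transition[OF s q(1,2) this] q show ?case
        by (simp add: h_def g_def \<tau>_def)
    qed
  qed
  ultimately have "s i has_laurent_expansion fps_to_fls H * fls_compose_fps F T"
    by (simp add: has_laurent_expansion_cong)
  then have G: "germ s p = fps_to_fls H * fls_compose_fps F T"
    unfolding i_def by (rule germ_eqI)
  with False have nz: "fls_compose_fps F T \<noteq> 0" by auto
  then have "F \<noteq> 0" by auto
  have "fls_subdegree (germ s p) = fls_subdegree F"
    using H_sub nz T_nz T0 by (simp add: G T_sub)
  also have "\<dots> = zorder (s j) (\<tau> 0)"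
    using has_laurent_expansion_zorder[OF F \<open>F \<noteq> 0\<close>] by simp
  finally have "d \<le> fls_subdegree (germ s p)"
    using d' by (simp add: \<tau>0)
  then show ?thesis by (auto simp: vanishes_below_def)
qed

definition order_filtration :: "real \<Rightarrow> int \<Rightarrow> 'i sec set" where
  "order_filtration lam d =
     {s \<in> F_space X L A lam. \<forall>p\<in>{1..K}. vanishes_below d (germ s p)}"

lemma order_filtration_subset: "order_filtration lam d \<subseteq> F_space X L A lam"
  by (auto simp: order_filtration_def)

lemma subspace_order_filtration: "sec.subspace (order_filtration lam d)"
proof (rule sec.subspaceI)
  show "0 \<in> order_filtration lam d"
    by (simp add: order_filtration_def sec.subspace_0[OF subspace_F_space] vanishes_below_def)
next
  fix s t assume st: "s \<in> order_filtration lam d" "t \<in> order_filtration lam d"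
  then have F: "s \<in> F_space X L A lam" "t \<in> F_space X L A lam"
    by (simp_all add: order_filtration_def)
  show "s + t \<in> order_filtration lam d"
    using st sec.subspace_add[OF subspace_F_space F]
    by (simp add: order_filtration_def germ_add[OF F] vanishes_below_def)
next
  fix a s assume s: "s \<in> order_filtration lam d"
  then have F: "s \<in> F_space X L A lam"
    by (simp add: order_filtration_def)
  show "sec_scale a s \<in> order_filtration lam d"
    using s sec.subspace_scale[OF subspace_F_space F]
    by (simp add: order_filtration_def germ_scale[OF F] vanishes_below_def)
qed

lemma order_filtration_antimono: "d \<le> d' \<Longrightarrow> order_filtration lam d' \<subseteq> order_filtration lam d"
  by (auto simp: order_filtration_def vanishes_below_def)

lemma order_filtration_exhaust:
  assumes "s \<in> F_space X L A lam"
  shows "\<exists>d. s \<in> order_filtration lam d"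
proof -
  have "bdd_below ((\<lambda>p. fls_subdegree (germ s p)) ` {1..K})" by simp
  then obtain d where "\<And>p. p \<in> {1..K} \<Longrightarrow> d \<le> fls_subdegree (germ s p)"
    unfolding bdd_below_def by blast
  then have "s \<in> order_filtration lam d"
    using assms by (force simp: order_filtration_def vanishes_below_def)
  then show ?thesis by blast
qed

lemma lie_derivative_filtration:
  assumes e: "e \<in> order_filtration (-1) a" and t: "t \<in> order_filtration \<mu> b" and \<mu>: "2 * \<mu> \<in> \<int>"
  shows "lie_derivative \<mu> e t \<in> order_filtration \<mu> (a + b - 1)"
proof -
  have F: "e \<in> F_space X L A (-1)" "t \<in> F_space X L A \<mu>"
    using e t order_filtration_subset by blast+
  have "vanishes_below (a + b - 1) (germ (lie_derivative \<mu> e t) p)" if "p \<in> {1..K}" for p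
    unfolding germ_lie_derivative[OF F that]
    by (rule vanishes_below_lie) (use e t that in \<open>auto simp: order_filtration_def\<close>)
  then show ?thesis
    using lie_derivative_closed[OF F \<mu>] by (simp add: order_filtration_def)
qed

text \<open>
  A field equal to \<open>z d/dz\<close> up to terms of order \<open>2\<close> at each in-point acts on the piece of order \<open>d\<close> by the
  scalar \<open>d + \<mu>\<close>; for \<open>\<mu> = -1\<close> and \<open>\<mu> = -1/2\<close> this is the degree of a basis element with leading
  term \<open>z\<^sup>d\<close>.
\<close>
lemma lie_derivative_euler:
  assumes e: "e \<in> F_space X L A (-1)"
    and euler: "\<And>p. p \<in> {1..K} \<Longrightarrow> vanishes_below 2 (germ e p - fls_X)"
    and t: "t \<in> order_filtration \<mu> d" and \<mu>: "2 * \<mu> \<in> \<int>"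
  shows "lie_derivative \<mu> e t - sec_scale (of_int d + of_real \<mu>) t \<in> order_filtration \<mu> (d + 1)"
proof -
  have t': "t \<in> F_space X L A \<mu>"
    using t order_filtration_subset by blast
  have F: "lie_derivative \<mu> e t \<in> F_space X L A \<mu>"
      "sec_scale (of_int d + of_real \<mu>) t \<in> F_space X L A \<mu>"
    by (rule lie_derivative_closed[OF e t' \<mu>], rule sec.subspace_scale[OF subspace_F_space t'])
  have "vanishes_below (d + 1) (germ (lie_derivative \<mu> e t - sec_scale (of_int d + of_real \<mu>) t) p)"
    if p: "p \<in> {1..K}" for p
    unfolding germ_diff[OF F p] germ_scale[OF t' p] germ_lie_derivative[OF e t' p]
    by (rule vanishes_below_euler) (use p euler t in \<open>auto simp: order_filtration_def\<close>)
  then show ?thesis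
    using sec.subspace_diff[OF subspace_F_space F] by (simp add: order_filtration_def)
qed

section \<open>Krichever--Novikov bases and the order filtration\<close>
definition span_from :: "(int \<Rightarrow> nat \<Rightarrow> 'i sec) \<Rightarrow> int \<Rightarrow> 'i sec set" where
  "span_from g m = sec.span ((\<lambda>(d, p). g d p) ` ({m..} \<times> {1..K}))"

lemma span_from_antimono: "m \<le> n \<Longrightarrow> span_from g n \<subseteq> span_from g m"
  unfolding span_from_def by (intro sec.span_mono image_mono) auto

lemma span_from_exhaust:
  assumes "s \<in> sec.span ((\<lambda>(d, p). g d p) ` (UNIV \<times> {1..K}))"
  shows "\<exists>m. s \<in> span_from g m"
  using assms
proof (induction rule: sec.span_induct_alt)
  case base
  show ?case unfolding span_from_def using sec.span_zero by blast
next
  case (step c x y)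
  then obtain d p m where x: "x = g d p" "p \<in> {1..K}" and y: "y \<in> span_from g m" by auto
  have "x \<in> span_from g d"
    unfolding span_from_def x(1) using x(2) by (intro sec.span_base) auto
  then have "x \<in> span_from g (min d m)" "y \<in> span_from g (min d m)"
    using y span_from_antimono[of "min d m" d g] span_from_antimono[of "min d m" m g] by auto
  then have "sec_scale c x + y \<in> span_from g (min d m)"
    unfolding span_from_def by (intro sec.span_add sec.span_scale)
  then show ?case by blast
qed

text \<open>
  Suppose that \<open>s\<close> has order at least \<open>n\<close> at all in-points and lies in the span of the basis elements
  of index at least \<open>m < n\<close>. The coefficients of \<open>z\<^sup>m\<close> at the in-points are the coordinates of \<open>s\<close> with
  respect to the \<open>g m p\<close>, because the basis elements of larger index do not contribute to them. They
  vanish, so \<open>s\<close> lies in the span of the elements of index at least \<open>m + 1\<close>.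
\<close>
lemma order_filtration_subset_span_from:
  assumes g: "\<And>d p. p \<in> {1..K} \<Longrightarrow> g d p \<in> order_filtration lam d"
    and lead: "\<And>d p q. \<lbrakk>p \<in> {1..K}; q \<in> {1..K}\<rbrakk> \<Longrightarrow> fls_nth (germ (g d p) q) d = of_bool (q = p)"
    and span: "sec.span ((\<lambda>(d, p). g d p) ` (UNIV \<times> {1..K})) = F_space X L A lam"
  shows "order_filtration lam n \<subseteq> span_from g n"
proof
  fix s assume s: "s \<in> order_filtration lam n"
  then have sF: "s \<in> F_space X L A lam"
    using order_filtration_subset by blast
  have g_F: "g d p \<in> F_space X L A lam" if "p \<in> {1..K}" for d p
    using g[OF that] order_filtration_subset by blast
  have span_from_sub: "span_from g m \<subseteq> order_filtration lam m" for m
    unfolding span_from_def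
  proof (rule sec.span_minimal[OF _ subspace_order_filtration])
    show "(\<lambda>(d, p). g d p) ` ({m..} \<times> {1..K}) \<subseteq> order_filtration lam m"
      using g order_filtration_antimono[of m] by fastforce
  qed
  have degree: "x \<in> F_space X L A lam \<and>
      x = (\<Sum>p\<in>{1..K}. sec_scale (fls_nth (germ x p) m) (g m p))"
    if "x \<in> sec.span (g m ` {1..K})" for x m
    using that
  proof (induction rule: sec.span_induct_alt)
    case base
    have "(\<Sum>p\<in>{1..K}. sec_scale (fls_nth (germ 0 p) m) (g m p)) = 0"
      by (intro sum.neutral ballI) (simp only: germ_zero fls_zero_nth sec.scale_zero_left)
    then show ?case using sec.subspace_0[OF subspace_F_space] by metis
  next
    case (step c x y)
    then obtain q where q: "q \<in> {1..K}" "x = g m q" by blast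
    have xF: "x \<in> F_space X L A lam" using g_F q by simp
    have yF: "y \<in> F_space X L A lam"
      and y: "y = (\<Sum>p\<in>{1..K}. sec_scale (fls_nth (germ y p) m) (g m p))"
      using step by blast+
    have cxF: "sec_scale c x \<in> F_space X L A lam"
      using sec.subspace_scale[OF subspace_F_space xF] .
    have "(\<Sum>p\<in>{1..K}. sec_scale (fls_nth (germ (sec_scale c x + y) p) m) (g m p))
        = (\<Sum>p\<in>{1..K}. (if p = q then sec_scale c x else 0)
             + sec_scale (fls_nth (germ y p) m) (g m p))"
    proof (rule sum.cong[OF refl])
      fix p assume p: "p \<in> {1..K}"
      have "fls_nth (germ (sec_scale c x + y) p) m = c * of_bool (p = q) + fls_nth (germ y p) m"
        unfolding germ_add[OF cxF yF p] germ_scale[OF xF p] using lead[OF q(1) p] q by simp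
      then show "sec_scale (fls_nth (germ (sec_scale c x + y) p) m) (g m p) =
          (if p = q then sec_scale c x else 0) + sec_scale (fls_nth (germ y p) m) (g m p)"
        using q by (cases "p = q") (simp_all only: sec.scale_left_distrib of_bool_eq if_True if_False
            mult_1_right mult_zero_right add_0_left simp_thms)
    qed
    also have "\<dots> = sec_scale c x + y"
      using q by (simp only: sum.distrib sum.delta finite_atLeastAtMost if_True flip: y)
    finally have "sec_scale c x + y =
        (\<Sum>p\<in>{1..K}. sec_scale (fls_nth (germ (sec_scale c x + y) p) m) (g m p))" ..
    with sec.subspace_add[OF subspace_F_space cxF yF] show ?case by blast
  qed
  have deeper: "s \<in> span_from g (m + 1)" if "s \<in> span_from g m" "m < n" for m
  proof -
    have "({m..} \<times> {1..K}) = ({m} \<times> {1..K}) \<union> ({m + 1..} \<times> {1..K})" by auto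
    moreover have "(\<lambda>(d, p). g d p) ` ({m} \<times> {1..K}) = g m ` {1..K}" by force
    ultimately have "(\<lambda>(d, p). g d p) ` ({m..} \<times> {1..K}) =
        g m ` {1..K} \<union> (\<lambda>(d, p). g d p) ` ({m + 1..} \<times> {1..K})"
      by (simp only: image_Un)
    with that(1) obtain x y where xy: "s = x + y" "x \<in> sec.span (g m ` {1..K})" "y \<in> span_from g (m + 1)"
      unfolding span_from_def by (auto simp only: sec.span_Un)
    have xF: "x \<in> F_space X L A lam"
      and x: "x = (\<Sum>p\<in>{1..K}. sec_scale (fls_nth (germ x p) m) (g m p))"
      using degree[OF xy(2)] by blast+
    have y: "y \<in> order_filtration lam (m + 1)"
      using xy(3) span_from_sub by blast
    then have yF: "y \<in> F_space X L A lam"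
      using order_filtration_subset by blast
    have "fls_nth (germ x p) m = 0" if p: "p \<in> {1..K}" for p
    proof -
      have "fls_nth (germ s p) m = 0" "fls_nth (germ y p) m = 0"
        using s y p \<open>m < n\<close> by (auto simp: order_filtration_def vanishes_below_def)
      then show ?thesis
        unfolding xy(1) germ_add[OF xF yF p] by simp
    qed
    then have "x = 0"
      by (subst x) (intro sum.neutral ballI, simp only: sec.scale_zero_left)
    with xy show ?thesis by simp
  qed
  obtain m where m: "s \<in> span_from g m"
    using span_from_exhaust sF span by blast
  have "s \<in> span_from g k" if "m \<le> k" "k \<le> n" for k
    using that
  proof (induction k rule: int_ge_induct)
    case base
    show ?case by (rule m)
  next
    case (step k)
    then show ?case using deeper by simp
  qed
  then show "s \<in> span_from g n"
    using m span_from_antimono[of n m g] by (cases "m \<le> n") auto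
qed

end

text \<open>
  Reindexing the basis by the order \<open>d = n - \<lambda>\<close> of its leading term, which is an integer for both
  weights.
\<close>

lemma KN_index_eq:
  assumes "lam \<in> {-1, -1/2}"
  shows "KN_index lam = range (\<lambda>d. real_of_int d + lam)"
proof -
  have half: "(- 1/2 :: real) \<notin> \<int>"
  proof
    assume "(- 1/2 :: real) \<in> \<int>"
    then obtain k where "(- 1/2 :: real) = of_int k" by (rule Ints_cases)
    then have "real_of_int (2 * k + 1) = 0" by simp
    then have "2 * k + 1 = 0" by (simp only: of_int_eq_0_iff)
    then show False by presburger
  qed
  show ?thesis
  proof (cases "lam = -1")
    case True
    have "n \<in> range (\<lambda>d. real_of_int d - 1)" if "n \<in> \<int>" for n
      using that by (elim Ints_cases) (auto intro!: image_eqI[of _ _ "_ + 1"])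
    then show ?thesis by (auto simp: KN_index_def True)
  next
    case False
    with assms have lam: "lam = -1/2" by simp
    have "n \<in> range (\<lambda>d. real_of_int d - 1/2)" if "n - 1/2 \<in> \<int>" for n
    proof -
      obtain k where "n - 1/2 = of_int k" using \<open>n - 1/2 \<in> \<int>\<close> by (rule Ints_cases)
      then have "n = of_int (k + 1) - 1/2" by simp
      then show ?thesis by blast
    qed
    moreover have "real_of_int d - 1/2 - 1/2 \<in> \<int>" for d
    proof -
      have "real_of_int d - 1/2 - 1/2 = of_int (d - 1)" by simp
      then show ?thesis by (metis Ints_of_int)
    qed
    ultimately show ?thesis using half by (auto simp: KN_index_def lam)
  qed
qed

text \<open>
  The \<open>d\<close>-th coefficients of the \<open>g d p\<close> at the in-points form the unit matrix: \<open>g d p\<close> has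
  leading term \<open>z\<^sup>d\<close> at its own point and higher order at the others.
\<close>
definition (in in_pointed_surface) adapted_basis :: "real \<Rightarrow> (int \<Rightarrow> nat \<Rightarrow> 'i sec) \<Rightarrow> bool" where
  "adapted_basis lam g \<longleftrightarrow>
     (\<forall>d. \<forall>p\<in>{1..K}. g d p \<in> order_filtration lam d \<and>
        (\<forall>q\<in>{1..K}. fls_nth (germ (g d p) q) d = of_bool (q = p))) \<and>
     sec.span ((\<lambda>(d, p). g d p) ` (UNIV \<times> {1..K})) = F_space X L A lam"

lemma (in in_pointed_surface) KN_bases_adapted:
  assumes bases: "KN_bases X L K M P Q zc C f"
    and A: "A = P ` {1..K} \<union> Q ` {1..M}" and lam: "lam \<in> {-1, -1/2}"
  shows "adapted_basis lam (\<lambda>d p. f lam (of_int d + lam) p)"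
proof -
  define g where "g = (\<lambda>d p. f lam (real_of_int d + lam) p)"
  have lam': "lam \<in> {-1, -1/2, 3/2, 2}" using lam by auto
  note KN = bases[unfolded KN_bases_def Let_def, folded A]
  have "sec.span ((\<lambda>(n, p). f lam n p) ` (KN_index lam \<times> {1..K})) = F_space X L A lam"
    using KN lam' by blast
  moreover have "(\<lambda>(n, p). f lam n p) ` (KN_index lam \<times> {1..K}) = (\<lambda>(d, p). g d p) ` (UNIV \<times> {1..K})"
    unfolding KN_index_eq[OF lam] g_def by (auto intro!: image_eqI)
  ultimately have span: "sec.span ((\<lambda>(d, p). g d p) ` (UNIV \<times> {1..K})) = F_space X L A lam"
    by simp
  have "g d p \<in> order_filtration lam d \<and> (\<forall>q\<in>{1..K}. fls_nth (germ (g d p) q) d = of_bool (q = p))"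
    if p: "p \<in> {1..K}" for d p
  proof -
    have gF: "g d p \<in> F_space X L A lam"
      unfolding span[symmetric] using p by (intro sec.span_base) auto
    have n: "real_of_int d + lam \<in> KN_index lam"
      unfolding KN_index_eq[OF lam] by blast
    have orders: "(\<forall>i \<in> {1..K}. sec_order X (g d p) (P i) \<ge> (real_of_int d + lam + 1 - lam) - of_bool (i = p)) \<and>
          (\<exists>u. u \<in> O[at 0](\<lambda>w. w) \<and>
               (\<forall>\<^sub>F w in at 0. g d p (zc p) w = w powi \<lfloor>real_of_int d + lam - lam\<rfloor> * (1 + u w)))"
      unfolding g_def using KN lam' n p by blast
    have "vanishes_below d (germ (g d p) q) \<and> fls_nth (germ (g d p) q) d = of_bool (q = p)"
      if q: "q \<in> {1..K}" for q
    proof (cases "q = p")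
      case True
      obtain u where u: "u \<in> O[at 0](\<lambda>w. w)" "\<forall>\<^sub>F w in at 0. g d p (zc p) w = w powi d * (1 + u w)"
        using orders by auto
      show ?thesis
        using laurent_leading_term[OF has_germ[OF gF p] u] True by simp
    next
      case False
      have "real_of_int (d + 1) \<le> sec_order X (g d p) (P q)"
        using orders q False by fastforce
      then have "d + 1 \<le> sec_order X (g d p) (P q)" by linarith
      from vanishes_below_germ_of_sec_order[OF gF q this] show ?thesis
        using False by (simp add: vanishes_below_def)
    qed
    then show ?thesis using gF by (simp add: order_filtration_def)
  qed
  then show ?thesis
    using span unfolding adapted_basis_def g_def by blast
qed

context in_pointed_surface
begin

text \<open>
  Each in-point receives the leading term \<open>z\<close> from exactly one summand. Order \<open>1\<close> corresponds to
  degree \<open>0\<close> for vector fields.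
\<close>
lemma adapted_basis_euler_field:
  assumes g: "adapted_basis (-1) g"
  defines "e \<equiv> \<Sum>p\<in>{1..K}. g 1 p"
  shows "e \<in> order_filtration (-1) 1"
    and "q \<in> {1..K} \<Longrightarrow> vanishes_below 2 (germ e q - fls_X)"
proof -
  have g1: "g 1 p \<in> order_filtration (-1) 1" if "p \<in> {1..K}" for p
    using g that by (simp add: adapted_basis_def)
  then have g1F: "g 1 p \<in> F_space X L A (-1)" if "p \<in> {1..K}" for p
    using that order_filtration_subset by blast
  show e: "e \<in> order_filtration (-1) 1"
    unfolding e_def by (intro sec.subspace_sum[OF subspace_order_filtration] g1)
  assume q: "q \<in> {1..K}"
  have germ_e: "germ e q = (\<Sum>p\<in>{1..K}. germ (g 1 p) q)"
    unfolding e_def by (rule germ_sum[OF finite_atLeastAtMost g1F q])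
  have "fls_nth (germ e q) 1 = (\<Sum>p\<in>{1..K}. fls_nth (germ (g 1 p) q) 1)"
    unfolding germ_e by (rule fls_nth_sum)
  also have "\<dots> = (\<Sum>p\<in>{1..K}. of_bool (q = p))"
    by (rule sum.cong[OF refl]) (use g q in \<open>simp add: adapted_basis_def\<close>)
  also have "\<dots> = 1" using q by (simp add: of_bool_def)
  finally have "fls_nth (germ e q) 1 = 1" .
  moreover have "vanishes_below 1 (germ e q)"
    using e q by (simp add: order_filtration_def)
  ultimately show "vanishes_below 2 (germ e q - fls_X)"
    unfolding vanishes_below_def by (auto simp: fls_X_def)
qed

lemma adapted_basis_span:
  assumes "adapted_basis lam g"
  shows "order_filtration lam n \<subseteq> span_from g n"
  using assms unfolding adapted_basis_def by (intro order_filtration_subset_span_from) blast+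

end

section \<open>The mixed part of an odd cocycle\<close>

definition mixed_part :: "('i super \<Rightarrow> 'i super \<Rightarrow> complex) \<Rightarrow> 'i sec \<Rightarrow> 'i sec \<Rightarrow> complex" where
  "mixed_part c e \<phi> = c (e, 0) (0, \<phi>)"

lemma lie_derivative_zero [simp]: "lie_derivative \<mu> e 0 = 0" "lie_derivative \<mu> 0 t = 0"
  by (simp_all add: lie_derivative_def zero_fun_def)

lemma sec_mult_zero [simp]: "sec_mult s 0 = 0" "sec_mult 0 s = 0"
  by (simp_all add: sec_mult_def zero_fun_def)

lemma super_bracket_eq:
  "super_bracket (e, \<phi>) (f, \<psi>) =
     (lie_derivative (-1) e f + sec_mult \<phi> \<psi>, lie_derivative (-1/2) e \<psi> - lie_derivative (-1/2) f \<phi>)"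
  by (simp add: super_bracket_def vf_bracket_eq_lie vf_action_eq_lie)

context punctured_surface
begin

lemma zero_mem_F_space: "0 \<in> F_space X L A lam"
  by (rule sec.subspace_0[OF subspace_F_space])

lemma
  assumes c: "odd_super_cocycle X L A c" and x: "x \<in> super_space X L A" and y: "y \<in> super_space X L A"
  shows cocycle_add_right: "y' \<in> super_space X L A \<Longrightarrow> c x (y + y') = c x y + c x y'"
    and cocycle_scale_right: "c x (super_scale a y) = a * c x y"
    and cocycle_add_left: "x' \<in> super_space X L A \<Longrightarrow> c (x + x') y = c x y + c x' y"
    and cocycle_scale_left: "c (super_scale a x) y = a * c x y"
proof -
  have "linear_functional_on (super_space X L A) (\<lambda>y. c x y)"
    using c x unfolding odd_super_cocycle_def by blast
  then show "y' \<in> super_space X L A \<Longrightarrow> c x (y + y') = c x y + c x y'"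
    and "c x (super_scale a y) = a * c x y"
    using y unfolding linear_functional_on_def by blast+
  have "linear_functional_on (super_space X L A) (\<lambda>x. c x y)"
    using c y unfolding odd_super_cocycle_def by blast
  then show "x' \<in> super_space X L A \<Longrightarrow> c (x + x') y = c x y + c x' y"
    and "c (super_scale a x) y = a * c x y"
    using x unfolding linear_functional_on_def by blast+
qed

lemma
  assumes c: "odd_super_cocycle X L A c"
    and e: "e \<in> F_space X L A (-1)" and t: "t \<in> F_space X L A (-1/2)"
  shows mixed_part_add_left:
      "e' \<in> F_space X L A (-1) \<Longrightarrow> mixed_part c (e + e') t = mixed_part c e t + mixed_part c e' t"
    and mixed_part_add_right:
      "t' \<in> F_space X L A (-1/2) \<Longrightarrow> mixed_part c e (t + t') = mixed_part c e t + mixed_part c e t'"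
    and mixed_part_scale_left: "mixed_part c (sec_scale a e) t = a * mixed_part c e t"
    and mixed_part_scale_right: "mixed_part c e (sec_scale a t) = a * mixed_part c e t"
proof -
  have mem: "(s, 0) \<in> super_space X L A" "(0, u) \<in> super_space X L A"
    if "s \<in> F_space X L A (-1)" "u \<in> F_space X L A (-1/2)" for s u
    using that zero_mem_F_space by (simp_all add: super_space_def)
  note et = mem[OF e t]
  show "mixed_part c (e + e') t = mixed_part c e t + mixed_part c e' t"
    if "e' \<in> F_space X L A (-1)"
    using cocycle_add_left[OF c et mem(1)[OF that t]]
    unfolding mixed_part_def add_Pair add_0_left .
  show "mixed_part c e (t + t') = mixed_part c e t + mixed_part c e t'"
    if "t' \<in> F_space X L A (-1/2)"
    using cocycle_add_right[OF c et mem(2)[OF e that]]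
    unfolding mixed_part_def add_Pair add_0_left .
  show "mixed_part c (sec_scale a e) t = a * mixed_part c e t"
    using cocycle_scale_left[OF c et, of a]
    unfolding mixed_part_def super_scale_def fst_conv snd_conv sec.scale_zero_right .
  show "mixed_part c e (sec_scale a t) = a * mixed_part c e t"
    using cocycle_scale_right[OF c et, of a]
    unfolding mixed_part_def super_scale_def fst_conv snd_conv sec.scale_zero_right .
qed

lemma mixed_part_cocycle:
  assumes c: "odd_super_cocycle X L A c"
    and e: "e \<in> F_space X L A (-1)" and f: "f \<in> F_space X L A (-1)" and t: "t \<in> F_space X L A (-1/2)"
  shows "mixed_part c (lie_derivative (-1) e f) t =
    mixed_part c e (lie_derivative (-1/2) f t) - mixed_part c f (lie_derivative (-1/2) e t)"
proof -
  have ef: "lie_derivative (-1) e f \<in> F_space X L A (-1)"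
    by (rule lie_derivative_closed[OF e f]) simp
  have et: "lie_derivative (-1/2) e t \<in> F_space X L A (-1/2)"
    by (rule lie_derivative_closed[OF e t]) simp
  have even: "(s, 0) \<in> super_part X L A 0" if "s \<in> F_space X L A (-1)" for s
    using that by (simp add: super_part_def)
  have odd: "(0, s) \<in> super_part X L A 1" if "s \<in> F_space X L A (-1/2)" for s
    using that by (simp add: super_part_def)
  have skew: "\<forall>a \<in> {0, 1}. \<forall>b \<in> {0, 1}. \<forall>x \<in> super_part X L A a. \<forall>y \<in> super_part X L A b.
        c x y = - ((-1) ^ (a * b) * c y x)"
    using c unfolding odd_super_cocycle_def by blast
  have cyc: "\<forall>a \<in> {0, 1}. \<forall>b \<in> {0, 1}. \<forall>d \<in> {0, 1}.
        \<forall>x \<in> super_part X L A a. \<forall>y \<in> super_part X L A b. \<forall>z \<in> super_part X L A d.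
          (-1) ^ (a * d) * c x (super_bracket y z)
          + (-1) ^ (b * a) * c y (super_bracket z x)
          + (-1) ^ (d * b) * c z (super_bracket x y) = 0"
    using c unfolding odd_super_cocycle_def by blast
  have "(-1) ^ (0 * 1) * c (e, 0) (super_bracket (f, 0) (0, t))
      + (-1) ^ (0 * 0) * c (f, 0) (super_bracket (0, t) (e, 0))
      + (-1) ^ (1 * 0) * c (0, t) (super_bracket (e, 0) (f, 0)) = 0"
    by (rule cyc[rule_format]) (use even[OF e] even[OF f] odd[OF t] in simp_all)
  then have "c (e, 0) (0, lie_derivative (-1/2) f t) + c (f, 0) (0, - lie_derivative (-1/2) e t)
      + c (0, t) (lie_derivative (-1) e f, 0) = 0"
    unfolding super_bracket_eq lie_derivative_zero sec_mult_zero by simp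
  moreover have "c (0, t) (lie_derivative (-1) e f, 0) =
      - ((-1) ^ (1 * 0) * c (lie_derivative (-1) e f, 0) (0, t))"
    by (rule skew[rule_format]) (use even[OF ef] odd[OF t] in simp_all)
  moreover have "c (f, 0) (0, - lie_derivative (-1/2) e t) = - c (f, 0) (0, lie_derivative (-1/2) e t)"
  proof -
    have "- lie_derivative (-1/2) e t = sec_scale (-1) (lie_derivative (-1/2) e t)" by simp
    then show ?thesis
      using mixed_part_scale_right[OF c f et, of "-1"] unfolding mixed_part_def by simp
  qed
  ultimately show ?thesis by (simp add: mixed_part_def)
qed

lemma cocycle_eq_mixed_part:
  assumes c: "odd_super_cocycle X L A c"
    and e: "e \<in> F_space X L A (-1)" "f \<in> F_space X L A (-1)"
    and t: "t \<in> F_space X L A (-1/2)" "u \<in> F_space X L A (-1/2)"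
  shows "c (e, t) (f, u) = mixed_part c e u - mixed_part c f t"
proof -
  have even: "(s, 0) \<in> super_part X L A 0" "(s, 0) \<in> super_space X L A" if "s \<in> F_space X L A (-1)" for s
    using that zero_mem_F_space by (simp_all add: super_part_def super_space_def)
  have odd: "(0, s) \<in> super_part X L A 1" "(0, s) \<in> super_space X L A" if "s \<in> F_space X L A (-1/2)" for s
    using that zero_mem_F_space by (simp_all add: super_part_def super_space_def)
  have skew: "\<forall>a \<in> {0, 1}. \<forall>b \<in> {0, 1}. \<forall>x \<in> super_part X L A a. \<forall>y \<in> super_part X L A b.
        c x y = - ((-1) ^ (a * b) * c y x)"
    using c unfolding odd_super_cocycle_def by blast
  have same: "\<forall>a \<in> {0, 1}. \<forall>x \<in> super_part X L A a. \<forall>y \<in> super_part X L A a. c x y = 0"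
    using c unfolding odd_super_cocycle_def by blast
  have et: "(e, t) = (e, 0) + (0, t)" "(f, u) = (f, 0) + (0, u)" by simp_all
  have fu: "(f, 0) + (0, u) \<in> super_space X L A"
    using e t by (simp add: super_space_def)
  have "c (e, t) (f, u) = c (e, 0) (f, 0) + c (e, 0) (0, u) + (c (0, t) (f, 0) + c (0, t) (0, u))"
    unfolding et
    by (simp only: cocycle_add_left[OF c even(2)[OF e(1)] fu odd(2)[OF t(1)]]
        cocycle_add_right[OF c even(2)[OF e(1)] even(2)[OF e(2)] odd(2)[OF t(2)]]
        cocycle_add_right[OF c odd(2)[OF t(1)] even(2)[OF e(2)] odd(2)[OF t(2)]])
  moreover have "c (e, 0) (f, 0) = 0"
    by (rule same[rule_format, of 0]) (use even e in simp_all)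
  moreover have "c (0, t) (0, u) = 0"
    by (rule same[rule_format, of 1]) (use odd t in simp_all)
  moreover have "c (0, t) (f, 0) = - ((-1) ^ (1 * 0) * c (f, 0) (0, t))"
    by (rule skew[rule_format]) (use even[OF e(2)] odd[OF t(1)] in simp_all)
  ultimately show ?thesis by (simp add: mixed_part_def)
qed

end

section \<open>Bounded odd cocycles are coboundaries\<close>
context in_pointed_surface
begin

text \<open>
  Basis elements of orders \<open>d\<close> and \<open>d'\<close> have degrees \<open>d - 1\<close> and \<open>d' - 1/2\<close>; boundedness makes the
  cocycle vanish on them when \<open>R + 2 \<le> d + d'\<close>. This extends bilinearly to the spans, which contain
  the steps of the order filtration.
\<close>
lemma mixed_part_bounded:
  assumes c: "odd_super_cocycle X L A c" and bounded: "bounded_cocycle K f c"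
    and gL: "adapted_basis (-1) (\<lambda>d p. f (-1) (of_int d + (-1)) p)"
    and gF: "adapted_basis (-1/2) (\<lambda>d p. f (-1/2) (of_int d + (-1/2)) p)"
  obtains R :: int where "\<And>n m e t. \<lbrakk>e \<in> order_filtration (-1) (n + 1);
     t \<in> order_filtration (-1/2) (m + 1); R \<le> n + m\<rbrakk> \<Longrightarrow> mixed_part c e t = 0"
proof -
  obtain R :: int where R: "\<And>n m x y. \<lbrakk>2 * n \<in> \<int>; 2 * m \<in> \<int>; x \<in> S_degree K f n;
      y \<in> S_degree K f m; c x y \<noteq> 0\<rbrakk> \<Longrightarrow> n + m \<le> R"
    using bounded unfolding bounded_cocycle_def by blast
  define gE where "gE = (\<lambda>d p. f (-1) (real_of_int d + (-1)) p)"
  define gO where "gO = (\<lambda>d p. f (-1/2) (real_of_int d + (-1/2)) p)"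
  have basis_zero: "mixed_part c (gE d p) (gO d' q) = 0"
    if pq: "p \<in> {1..K}" "q \<in> {1..K}" and d: "R + 2 \<le> d + d'" for d p d' q
  proof (rule ccontr)
    assume nz: "mixed_part c (gE d p) (gO d' q) \<noteq> 0"
    define n where "n = real_of_int d + (-1)"
    define m where "m = real_of_int d' + (-1/2)"
    have n: "n \<in> \<int>" by (simp add: n_def)
    have m: "m \<notin> \<int>"
    proof
      assume "m \<in> \<int>"
      then obtain k where "m = of_int k" by (rule Ints_cases)
      then have "real_of_int (2 * d' - 1) = of_int (2 * k)" by (simp add: m_def field_simps)
      then have "2 * d' - 1 = 2 * k" by (simp only: of_int_eq_iff)
      then show False by presburger
    qed
    have "2 * n = of_int (2 * d - 2)" "2 * m = of_int (2 * d' - 1)"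
      by (simp_all add: n_def m_def)
    then have Ints: "2 * n \<in> \<int>" "2 * m \<in> \<int>" by (metis Ints_of_int)+
    have "(gE d p, 0) \<in> S_degree K f n"
      using pq n by (simp add: S_degree_def F_degree_def gE_def n_def sec.span_base)
    moreover have "(0, gO d' q) \<in> S_degree K f m"
      using pq m by (simp add: S_degree_def F_degree_def gO_def m_def sec.span_base)
    ultimately have "n + m \<le> R"
      using R[OF Ints] nz unfolding mixed_part_def by blast
    then show False using d by (simp add: n_def m_def)
  qed
  have "mixed_part c e t = 0"
    if e: "e \<in> order_filtration (-1) (n + 1)" and t: "t \<in> order_filtration (-1/2) (m + 1)"
      and nm: "R \<le> n + m" for e t n m
  proof -
    have gE_F: "gE d p \<in> F_space X L A (-1)" if "p \<in> {1..K}" for d p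
      using gL that order_filtration_subset unfolding adapted_basis_def gE_def by blast
    have gO_F: "gO d p \<in> F_space X L A (-1/2)" if "p \<in> {1..K}" for d p
      using gF that order_filtration_subset unfolding adapted_basis_def gO_def by blast
    have left: "mixed_part c u (gO d q) = 0"
      if u: "u \<in> span_from gE (n + 1)" and q: "q \<in> {1..K}" and d: "m + 1 \<le> d" for u d q
    proof -
      define U where "U = {u \<in> F_space X L A (-1). mixed_part c u (gO d q) = 0}"
      have "sec.subspace U"
      proof (rule sec.subspaceI)
        show "0 \<in> U"
          using mixed_part_scale_left[OF c zero_mem_F_space gO_F[OF q], of 0] zero_mem_F_space
          unfolding U_def sec.scale_zero_right mem_Collect_eq by (metis mult_zero_left)
      next
        fix x y assume "x \<in> U" "y \<in> U"
        then show "x + y \<in> U"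
          using mixed_part_add_left[OF c _ gO_F[OF q]] sec.subspace_add[OF subspace_F_space]
          unfolding U_def mem_Collect_eq by (metis add_0_left)
      next
        fix a x assume "x \<in> U"
        then show "sec_scale a x \<in> U"
          using mixed_part_scale_left[OF c _ gO_F[OF q]] sec.subspace_scale[OF subspace_F_space]
          unfolding U_def mem_Collect_eq by (metis mult_zero_right)
      qed
      moreover have "(\<lambda>(d, p). gE d p) ` ({n + 1..} \<times> {1..K}) \<subseteq> U"
        using basis_zero[OF _ q] gE_F d nm by (auto simp: U_def)
      ultimately have "span_from gE (n + 1) \<subseteq> U"
        unfolding span_from_def by (intro sec.span_minimal)
      then show ?thesis using u by (auto simp: U_def)
    qed
    have e': "e \<in> span_from gE (n + 1)" and eF: "e \<in> F_space X L A (-1)"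
      using e adapted_basis_span[OF gL] order_filtration_subset unfolding gE_def by blast+
    define U where "U = {u \<in> F_space X L A (-1/2). mixed_part c e u = 0}"
    have "sec.subspace U"
    proof (rule sec.subspaceI)
      show "0 \<in> U"
        using mixed_part_scale_right[OF c eF zero_mem_F_space, of 0] zero_mem_F_space
        unfolding U_def sec.scale_zero_right mem_Collect_eq by (metis mult_zero_left)
    next
      fix x y assume "x \<in> U" "y \<in> U"
      then show "x + y \<in> U"
        using mixed_part_add_right[OF c eF] sec.subspace_add[OF subspace_F_space]
        unfolding U_def mem_Collect_eq by (metis add_0_left)
    next
      fix a x assume "x \<in> U"
      then show "sec_scale a x \<in> U"
        using mixed_part_scale_right[OF c eF] sec.subspace_scale[OF subspace_F_space]
        unfolding U_def mem_Collect_eq by (metis mult_zero_right)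
    qed
    moreover have "(\<lambda>(d, p). gO d p) ` ({m + 1..} \<times> {1..K}) \<subseteq> U"
      using left[OF e'] gO_F by (auto simp: U_def)
    ultimately have "span_from gO (m + 1) \<subseteq> U"
      unfolding span_from_def by (intro sec.span_minimal)
    moreover have "t \<in> span_from gO (m + 1)"
      using t adapted_basis_span[OF gF] unfolding gO_def by blast
    ultimately show ?thesis by (auto simp: U_def)
  qed
  then show ?thesis using that by blast
qed

text \<open>
  The index shift by one turns orders into weights: order \<open>n + 1\<close> is degree \<open>n\<close> for vector fields
  and degree \<open>n + 1/2\<close> for sections of weight \<open>-1/2\<close>.
\<close>
lemma mixed_part_coboundary:
  assumes c: "odd_super_cocycle X L A c" and bounded: "bounded_cocycle K f c"
    and gL: "adapted_basis (-1) (\<lambda>d p. f (-1) (of_int d + (-1)) p)"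
    and gF: "adapted_basis (-1/2) (\<lambda>d p. f (-1/2) (of_int d + (-1/2)) p)"
  obtains \<kappa> where
    "\<And>s t. \<lbrakk>s \<in> F_space X L A (-1/2); t \<in> F_space X L A (-1/2)\<rbrakk> \<Longrightarrow> \<kappa> (s + t) = \<kappa> s + \<kappa> t"
    "\<And>a s. s \<in> F_space X L A (-1/2) \<Longrightarrow> \<kappa> (sec_scale a s) = a * \<kappa> s"
    "\<And>e t. \<lbrakk>e \<in> F_space X L A (-1); t \<in> F_space X L A (-1/2)\<rbrakk> \<Longrightarrow>
       mixed_part c e t = \<kappa> (lie_derivative (-1/2) e t)"
proof -
  define e\<^sub>0 where "e\<^sub>0 = (\<Sum>p\<in>{1..K}. f (-1) (of_int 1 + (-1)) p)"
  have e\<^sub>0: "e\<^sub>0 \<in> order_filtration (-1) 1"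
    and euler: "\<And>q. q \<in> {1..K} \<Longrightarrow> vanishes_below 2 (germ e\<^sub>0 q - fls_X)"
    unfolding e\<^sub>0_def using adapted_basis_euler_field[OF gL] by blast+
  have e\<^sub>0_F: "e\<^sub>0 \<in> F_space X L A (-1)" using e\<^sub>0 order_filtration_subset by blast
  obtain R where R: "\<And>n m e t. \<lbrakk>e \<in> order_filtration (-1) (n + 1);
     t \<in> order_filtration (-1/2) (m + 1); R \<le> n + m\<rbrakk> \<Longrightarrow> mixed_part c e t = 0"
    using mixed_part_bounded[OF c bounded gL gF] by blast
  have half: "2 * (-1/2 :: real) \<in> \<int>" "2 * (-1 :: real) \<in> \<int>" by simp_all
  interpret E: filtered_euler_cocycle sec_scale sec_scale "F_space X L A (-1)" "F_space X L A (-1/2)"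
    "\<lambda>n. order_filtration (-1) (n + 1)" "\<lambda>n. order_filtration (-1/2) (n + 1)"
    "lie_derivative (-1)" "lie_derivative (-1/2)" e\<^sub>0 "mixed_part c" R
  proof unfold_locales
    fix n :: int and v w v' w' :: "'i sec" and a :: complex
    show "lie_derivative (-1/2) v w \<in> order_filtration (-1/2) (n + m + 1)"
      if "v \<in> order_filtration (-1) (n + 1)" "w \<in> order_filtration (-1/2) (m + 1)" for m
      using lie_derivative_filtration[OF that half(1)] by (simp add: algebra_simps)
    show "lie_derivative (-1) e\<^sub>0 v - sec_scale (of_int n) v \<in> order_filtration (-1) (n + 1 + 1)"
      if "v \<in> order_filtration (-1) (n + 1)"
      using lie_derivative_euler[OF e\<^sub>0_F euler that half(2)] by simp
    show "lie_derivative (-1/2) e\<^sub>0 w - sec_scale (of_int n + 1/2) w \<in> order_filtration (-1/2) (n + 1 + 1)"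
      if w: "w \<in> order_filtration (-1/2) (n + 1)"
    proof -
      have "of_int (n + 1) + complex_of_real (-1/2) = of_int n + 1/2" by simp
      with lie_derivative_euler[OF e\<^sub>0_F euler w half(1)] show ?thesis by (simp only:)
    qed
    show "\<exists>n. v \<in> order_filtration (-1) (n + 1)" if "v \<in> F_space X L A (-1)"
      using order_filtration_exhaust[OF that] by (metis diff_add_cancel)
    show "\<exists>n. w \<in> order_filtration (-1/2) (n + 1)" if "w \<in> F_space X L A (-1/2)"
      using order_filtration_exhaust[OF that] by (metis diff_add_cancel)
    show "mixed_part c v w = 0"
      if "v \<in> order_filtration (-1) (n + 1)" "w \<in> order_filtration (-1/2) (m + 1)" "R \<le> n + m" for m
      using that by (rule R)
  qed (use e\<^sub>0 in \<open>simp_all only: subspace_F_space subspace_order_filtration order_filtration_subset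
      order_filtration_antimono lie_derivative_add_left lie_derivative_add_right
      lie_derivative_scale_left lie_derivative_scale_right mixed_part_add_left[OF c]
      mixed_part_add_right[OF c] mixed_part_scale_left[OF c] mixed_part_scale_right[OF c]
      mixed_part_cocycle[OF c] lie_derivative_jacobi[OF e\<^sub>0_F] e\<^sub>0_F add_0_left\<close>)
  show ?thesis
    using E.potential_add E.potential_scale E.is_coboundary that by blast
qed

end

theorem corollary5p7:
  fixes X :: "('i, 'a::t2_space) surface_atlas"
    and L :: "'i \<Rightarrow> 'i \<Rightarrow> 'a \<Rightarrow> complex"
    and K M :: nat
    and P Q :: "nat \<Rightarrow> 'a"
    and A :: "'a set"
    and zc :: "nat \<Rightarrow> 'i"
    and C :: "(real \<Rightarrow> 'a) list"
    and f :: "real \<Rightarrow> real \<Rightarrow> nat \<Rightarrow> 'i sec"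
    and c :: "'i super \<Rightarrow> 'i super \<Rightarrow> complex"
  assumes surface: "compact_riemann_surface X"
    and theta: "theta_characteristic X L"
    and in_points: "K \<ge> 1" "inj_on P {1..K}"
    and out_points: "M \<ge> 1" "inj_on Q {1..M}"
    and splitting: "P ` {1..K} \<inter> Q ` {1..M} = {}" "A = P ` {1..K} \<union> Q ` {1..M}"
    and coordinates: "\<And>p. p \<in> {1..K} \<Longrightarrow> P p \<in> patch X (zc p) \<and> chart X (zc p) (P p) = 0"
    and cycle: "separating_cycle X A K P zc C"
    and bases: "KN_bases X L K M P Q zc C f"
    and cocycle: "odd_super_cocycle X L A c"
    and bounded: "bounded_cocycle K f c"
  shows "odd_coboundary X L A c \<and> ext_splits X L A c"
proof -
  interpret in_pointed_surface X L A K P zc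
    using surface theta splitting(2) coordinates by unfold_locales auto
  obtain \<kappa> where add: "\<And>s t. \<lbrakk>s \<in> F_space X L A (-1/2); t \<in> F_space X L A (-1/2)\<rbrakk> \<Longrightarrow>
       \<kappa> (s + t) = \<kappa> s + \<kappa> t"
    and scale: "\<And>a s. s \<in> F_space X L A (-1/2) \<Longrightarrow> \<kappa> (sec_scale a s) = a * \<kappa> s"
    and mixed: "\<And>e t. \<lbrakk>e \<in> F_space X L A (-1); t \<in> F_space X L A (-1/2)\<rbrakk> \<Longrightarrow>
       mixed_part c e t = \<kappa> (lie_derivative (-1/2) e t)"
    using mixed_part_coboundary[OF cocycle bounded KN_bases_adapted[OF bases splitting(2)]
        KN_bases_adapted[OF bases splitting(2)]] by blast
  \<comment> \<open>Extended by zero to the even part, \<open>\<kappa>\<close> becomes an odd functional; its graph splits the extension.\<close>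
  define k :: "'i super \<Rightarrow> complex" where "k x = \<kappa> (snd x)" for x
  have linear: "linear_functional_on (super_space X L A) k"
    by (auto simp: linear_functional_on_def super_space_def super_scale_def k_def add scale)
  have "\<kappa> 0 = 0"
    using scale[OF zero_mem_F_space, of 0] by (metis mult_zero_left sec.scale_zero_right)
  then have even: "k x = 0" if "x \<in> super_part X L A 0" for x
    using that by (auto simp: super_part_def k_def)
  have eq: "c x y = k (super_bracket x y)"
    if xy: "x \<in> super_space X L A" "y \<in> super_space X L A" for x y
  proof -
    obtain e t g u where x: "x = (e, t)" "e \<in> F_space X L A (-1)" "t \<in> F_space X L A (-1/2)"
      and y: "y = (g, u)" "g \<in> F_space X L A (-1)" "u \<in> F_space X L A (-1/2)"
      using xy unfolding super_space_def by blast
    have closed: "lie_derivative (-1/2) e u \<in> F_space X L A (-1/2)"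
        "lie_derivative (-1/2) g t \<in> F_space X L A (-1/2)"
      using lie_derivative_closed[of _ _ "-1/2"] x y by simp_all
    have "\<kappa> (lie_derivative (-1/2) e u - lie_derivative (-1/2) g t)
        = \<kappa> (lie_derivative (-1/2) e u) - \<kappa> (lie_derivative (-1/2) g t)"
      using add[OF sec.subspace_diff[OF subspace_F_space closed] closed(2)]
      by (simp only: diff_add_cancel eq_diff_eq)
    then show ?thesis
      unfolding x(1) y(1) cocycle_eq_mixed_part[OF cocycle x(2) y(2) x(3) y(3)]
      by (simp only: super_bracket_eq k_def snd_conv mixed[OF x(2) y(3)] mixed[OF y(2) x(3)])
  qed
  have "odd_coboundary X L A c"
    unfolding odd_coboundary_def using linear even eq by blast
  moreover have "ext_splits X L A c"
    unfolding ext_splits_def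
  proof (intro exI[of _ "\<lambda>x. (k x, x)"] conjI ballI allI)
    show "(k x, x) \<in> ext_part X L A par" if "par \<in> {0, 1}" "x \<in> super_part X L A par" for par x
      using that even[of x] by (cases "par = 0") (simp_all add: ext_part_def)
  qed (use linear eq in \<open>auto simp: linear_functional_on_def ext_bracket_def\<close>)
  ultimately show ?thesis by blast
qed

end
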